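(* Let $s>1$, let $p_1,\dots,p_s$ be different prime numbers with $p_1,\dots,p_{s-1}$ odd, and let $r_i,n_i$ be positive integers. For $1\leq i\leq s$ let $Q_i$ be a non-degenerate quadratic form over $(\mathbb{Z}/(p_i^{r_i}))^{n_i}$ with associated bilinear form $b_i$, and let $f_i$ be an element of order $p_i^{r'_i}$ in the orthogonal group of $Q_i$, for some $0\leq r'_i\leq r_i$. For $1\leq i<s$ let $c_i$ be an element of order $p_{i+1}^{r_{i+1}}$ in the orthogonal group of $Q_i$; let $c_s$ be an element of order $p_1^{r_1}$ of $\operatorname{Aut}((\mathbb{Z}/(p_s^{r_s}))^{n_s})$ and let $v_s\in(\mathbb{Z}/(p_s^{r_s}))^{n_s}$ be such that $Q_s(c_s(\vec{x}))=Q_s(\vec{x})+v_s\vec{x}^t$ for all $\vec{x}$. Assume $f_ic_i=c_if_i$ for $1\leq i\leq s$. Let $H_1\bowtie\dots\bowtie H_s$ be the iterated matched product left brace determined by these data and let $B=T'\rtimes_\circ S'$ be the asymmetric product of $T'=(\mathbb{Z}/(p_1^{r_1}))^{n_1}\times\dots\times(\mathbb{Z}/(p_s^{r_s}))^{n_s}$ by $S'=\mathbb{Z}/(p_1^{r_1})\times\dots\times\mathbb{Z}/(p_s^{r_s})$ via $b'$ and $\alpha'$ (all described in the context). Then the map $\varphi'\colon H_1\bowtie\dots\bowtie H_s\to B$ defined by $$\varphi'(\vec{x}_1,\mu_1,\dots,\vec{x}_s,\mu_s)=(\vec{x}_1,\dots,\vec{x}_s,\mu_1-Q_1(\vec{x}_1),\dots,\mu_s-Q_s(\vec{x}_s))$$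 is an isomorphism of left braces.
   Context: A left brace is a set $B$ with two operations $+$ and $\cdot$ such that $(B,+)$ is an abelian group, $(B,\cdot)$ is a group and $a\cdot(b+c)+a=a\cdot b+a\cdot c$ for all $a,b,c\in B$. The lambda map is $\lambda_a(b)=a\cdot b-a$; together with $(B,+)$ it determines the multiplication by $a\cdot b=a+\lambda_a(b)$. A trivial brace is a left brace with $a\cdot b=a+b$; any abelian group is regarded as a trivial brace. An isomorphism of left braces is a bijection preserving $+$ and $\cdot$. Vectors are row vectors and $^t$ denotes transpose. The bilinear form associated to a quadratic form $Q$ is $b(\vec{x},\vec{y})=Q(\vec{x}+\vec{y})-Q(\vec{x})-Q(\vec{y})$; the orthogonal group of $Q$ consists of the module automorphisms $f$ with $Q(f(\vec{x}))=Q(\vec{x})$ for all $\vec x$. The left brace $H_1\bowtie\dots\bowtie H_s$: its additive group is the direct product of the additive groups $H_i=(\mathbb{Z}/(p_i^{r_i}))^{n_i}\times\mathbb{Z}/(p_i^{r_i})$, with elements written $(\vec{x}_1,\mu_1,\dots,\vec{x}_s,\mu_s)$, $\vec{x}_i\in(\mathbb{Z}/(p_i^{r_i}))^{n_i}$, $\mu_i\in\mathbb{Z}/(p_i^{r_i})$. Put $q_i=\mu_i-Q_i(\vec{x}_i)$. Its lambda map $\lambda_{(\vec{x}_1,\mu_1,\dots,\vec{x}_s,\mu_s)}$ sends $(\vec{y}_1,\mu'_1,\dots,\vec{y}_s,\mu'_s)$ to the element whose $H_i$-component, for $1\leq i<s$, is $$\bigl(f_i^{q_i}c_i^{q_{i+1}}(\vec{y}_i),\;\mu'_i+b_i(\vec{x}_i,f_i^{q_i}c_i^{q_{i+1}}(\vec{y}_i))\bigr),$$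 and whose $H_s$-component is $$\bigl(f_s^{q_s}c_s^{q_1}(\vec{y}_s),\;\mu'_s+v_s((\operatorname{id}+c_s+\dots+c_s^{q_1-1})(\vec{y}_s))^t+b_s(\vec{x}_s,f_s^{q_s}c_s^{q_1}(\vec{y}_s))\bigr),$$ where in the sum $\operatorname{id}+c_s+\dots+c_s^{q_1-1}$ the element $q_1\in\mathbb{Z}/(p_1^{r_1})$ is represented by any non-negative integer (empty sum if this integer is $0$); the value of $v_s(\cdots)^t$ does not depend on the choice. The left brace $B$: $T'$ and $S'$ are trivial braces. For $(\mu_1,\dots,\mu_s)\in S'$ define $\alpha'_{(\mu_1,\dots,\mu_s)}\in\operatorname{Aut}(T',+)$ by $$\alpha'_{(\mu_1,\dots,\mu_s)}(\vec{x}_1,\dots,\vec{x}_s)=(f_1^{\mu_1}c_1^{\mu_2}(\vec{x}_1),\dots,f_{s-1}^{\mu_{s-1}}c_{s-1}^{\mu_s}(\vec{x}_{s-1}),f_s^{\mu_s}c_s^{\mu_1}(\vec{x}_s)),$$ and define $b'\colon T'\times T'\to S'$ by $b'((\vec{x}_1,\dots,\vec{x}_s),(\vec{y}_1,\dots,\vec{y}_s))=(-b_1(\vec{x}_1,\vec{y}_1),\dots,-b_s(\vec{x}_s,\vec{y}_s))$. The asymmetric product $B=T'\rtimes_\circ S'$ is the set $T'\times S'$ with operations $$(t_1,s_1)+(t_2,s_2)=(t_1+t_2,\;s_1+s_2+b'(t_1,t_2)),\qquad(t_1,s_1)\cdot(t_2,s_2)=(t_1+\alpha'_{s_1}(t_2),\;s_1+s_2).$$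 *)

theory Defs
  imports "HOL-Algebra.Bij" "HOL-Algebra.Product_Groups" "HOL-Number_Theory.Residues"
begin

section \<open>Left braces\<close>

text \<open>
  A left brace is stored in a ring record: the additive group uses the fields \<open>add\<close> and
  \<open>zero\<close>, the multiplicative group uses \<open>mult\<close> and \<open>one\<close>.
\<close>

locale left_brace = abelian_group B + group B for B (structure) +
  assumes brace_compat:
    "\<lbrakk>a \<in> carrier B; b \<in> carrier B; c \<in> carrier B\<rbrakk>
      \<Longrightarrow> a \<otimes> (b \<oplus> c) \<oplus> a = a \<otimes> b \<oplus> a \<otimes> c"

definition brace_iso ::
    "('a, 'm) ring_scheme \<Rightarrow> ('b, 'n) ring_scheme \<Rightarrow> ('a \<Rightarrow> 'b) set" where
  "brace_iso B C =
    {h. bij_betw h (carrier B) (carrier C) \<and>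
        (\<forall>x\<in>carrier B. \<forall>y\<in>carrier B. h (x \<oplus>\<^bsub>B\<^esub> y) = h x \<oplus>\<^bsub>C\<^esub> h y) \<and>
        (\<forall>x\<in>carrier B. \<forall>y\<in>carrier B. h (x \<otimes>\<^bsub>B\<^esub> y) = h x \<otimes>\<^bsub>C\<^esub> h y)}"

text \<open>The structure with additive group \<open>A\<close> (written multiplicatively) and lambda map \<open>L\<close>.\<close>

definition brace_of_lambda :: "('a, 'm) monoid_scheme \<Rightarrow> ('a \<Rightarrow> 'a \<Rightarrow> 'a) \<Rightarrow> 'a ring" where
  "brace_of_lambda A L =
    \<lparr>carrier = carrier A, monoid.mult = (\<lambda>a b. a \<otimes>\<^bsub>A\<^esub> L a b), monoid.one = \<one>\<^bsub>A\<^esub>,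
     ring.zero = \<one>\<^bsub>A\<^esub>, ring.add = (\<lambda>a b. a \<otimes>\<^bsub>A\<^esub> b)\<rparr>"

definition trivial_brace :: "('a, 'm) monoid_scheme \<Rightarrow> 'a ring" where
  "trivial_brace A = brace_of_lambda A (\<lambda>a b. b)"

text \<open>
  The asymmetric product of left braces \<open>T\<close> by \<open>S\<close>. For trivial \<open>T\<close> and \<open>S\<close>, the products
  in the multiplication below are the sums of \<open>T\<close> and \<open>S\<close>.
\<close>

definition asym_product ::
    "('t, 'm) ring_scheme \<Rightarrow> ('u, 'n) ring_scheme \<Rightarrow> ('t \<Rightarrow> 't \<Rightarrow> 'u) \<Rightarrow> ('u \<Rightarrow> 't \<Rightarrow> 't)
      \<Rightarrow> ('t \<times> 'u) ring" where
  "asym_product T S b \<alpha> =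
    \<lparr>carrier = carrier T \<times> carrier S,
     monoid.mult = (\<lambda>(t1, s1) (t2, s2). (t1 \<otimes>\<^bsub>T\<^esub> \<alpha> s1 t2, s1 \<otimes>\<^bsub>S\<^esub> s2)),
     monoid.one = (\<one>\<^bsub>T\<^esub>, \<one>\<^bsub>S\<^esub>),
     ring.zero = (\<zero>\<^bsub>T\<^esub>, \<zero>\<^bsub>S\<^esub>),
     ring.add = (\<lambda>(t1, s1) (t2, s2). (t1 \<oplus>\<^bsub>T\<^esub> t2, s1 \<oplus>\<^bsub>S\<^esub> s2 \<oplus>\<^bsub>S\<^esub> b t1 t2))\<rparr>"


section \<open>Quadratic forms and orthogonal groups\<close>

text \<open>
  The module \<open>R\<^sup>n\<close> of vectors indexed by \<open>{1..n}\<close>. The record type also demands \<open>mult\<close> and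
  \<open>one\<close>; they are filled in componentwise and never used.
\<close>

definition free_module :: "('a, 'm) ring_scheme \<Rightarrow> nat \<Rightarrow> ('a, nat \<Rightarrow> 'a) module" where
  "free_module R n =
    \<lparr>carrier = {1..n} \<rightarrow>\<^sub>E carrier R,
     monoid.mult = (\<lambda>x y. \<lambda>j\<in>{1..n}. x j \<otimes>\<^bsub>R\<^esub> y j),
     monoid.one = (\<lambda>j\<in>{1..n}. \<one>\<^bsub>R\<^esub>),
     ring.zero = (\<lambda>j\<in>{1..n}. \<zero>\<^bsub>R\<^esub>),
     ring.add = (\<lambda>x y. \<lambda>j\<in>{1..n}. x j \<oplus>\<^bsub>R\<^esub> y j),
     smult = (\<lambda>a x. \<lambda>j\<in>{1..n}. a \<otimes>\<^bsub>R\<^esub> x j)\<rparr>"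

definition dot :: "('a, 'm) ring_scheme \<Rightarrow> nat \<Rightarrow> (nat \<Rightarrow> 'a) \<Rightarrow> (nat \<Rightarrow> 'a) \<Rightarrow> 'a" where
  "dot R n v x = (\<Oplus>\<^bsub>R\<^esub>j\<in>{1..n}. v j \<otimes>\<^bsub>R\<^esub> x j)"

definition bilinear_form ::
    "('a, 'm) ring_scheme \<Rightarrow> ('a, 'v, 'n) module_scheme \<Rightarrow> ('v \<Rightarrow> 'v \<Rightarrow> 'a) \<Rightarrow> bool" where
  "bilinear_form R M b \<longleftrightarrow>
    (\<forall>x\<in>carrier M. \<forall>y\<in>carrier M. b x y \<in> carrier R) \<and>
    (\<forall>x\<in>carrier M. \<forall>y\<in>carrier M. \<forall>z\<in>carrier M.
       b (x \<oplus>\<^bsub>M\<^esub> y) z = b x z \<oplus>\<^bsub>R\<^esub> b y z \<and> b z (x \<oplus>\<^bsub>M\<^esub> y) = b z x \<oplus>\<^bsub>R\<^esub> b z y) \<and>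
    (\<forall>a\<in>carrier R. \<forall>x\<in>carrier M. \<forall>y\<in>carrier M.
       b (a \<odot>\<^bsub>M\<^esub> x) y = a \<otimes>\<^bsub>R\<^esub> b x y \<and> b x (a \<odot>\<^bsub>M\<^esub> y) = a \<otimes>\<^bsub>R\<^esub> b x y)"

definition polar ::
    "('a, 'm) ring_scheme \<Rightarrow> ('a, 'v, 'n) module_scheme \<Rightarrow> ('v \<Rightarrow> 'a) \<Rightarrow> 'v \<Rightarrow> 'v \<Rightarrow> 'a" where
  "polar R M Q x y = Q (x \<oplus>\<^bsub>M\<^esub> y) \<ominus>\<^bsub>R\<^esub> Q x \<ominus>\<^bsub>R\<^esub> Q y"

definition quadratic_form ::
    "('a, 'm) ring_scheme \<Rightarrow> ('a, 'v, 'n) module_scheme \<Rightarrow> ('v \<Rightarrow> 'a) \<Rightarrow> bool" where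
  "quadratic_form R M Q \<longleftrightarrow>
    (\<forall>x\<in>carrier M. Q x \<in> carrier R) \<and>
    (\<forall>a\<in>carrier R. \<forall>x\<in>carrier M. Q (a \<odot>\<^bsub>M\<^esub> x) = a \<otimes>\<^bsub>R\<^esub> a \<otimes>\<^bsub>R\<^esub> Q x) \<and>
    bilinear_form R M (polar R M Q)"

definition nondegenerate ::
    "('a, 'm) ring_scheme \<Rightarrow> ('a, 'v, 'n) module_scheme \<Rightarrow> ('v \<Rightarrow> 'a) \<Rightarrow> bool" where
  "nondegenerate R M Q \<longleftrightarrow>
    (\<forall>x\<in>carrier M. (\<forall>y\<in>carrier M. polar R M Q x y = \<zero>\<^bsub>R\<^esub>) \<longrightarrow> x = \<zero>\<^bsub>M\<^esub>)"

definition module_Aut ::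
    "('a, 'm) ring_scheme \<Rightarrow> ('a, 'v, 'n) module_scheme \<Rightarrow> ('v \<Rightarrow> 'v) monoid" where
  "module_Aut R M = (AutoGroup (add_monoid M))
    \<lparr>carrier := {f \<in> auto (add_monoid M).
       \<forall>a\<in>carrier R. \<forall>x\<in>carrier M. f (a \<odot>\<^bsub>M\<^esub> x) = a \<odot>\<^bsub>M\<^esub> f x}\<rparr>"

definition orthogonal_group ::
    "('a, 'm) ring_scheme \<Rightarrow> ('a, 'v, 'n) module_scheme \<Rightarrow> ('v \<Rightarrow> 'a) \<Rightarrow> ('v \<Rightarrow> 'v) monoid" where
  "orthogonal_group R M Q = (module_Aut R M)
    \<lparr>carrier := {f \<in> carrier (module_Aut R M). \<forall>x\<in>carrier M. Q (f x) = Q x}\<rparr>"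


section \<open>The iterated matched product and the asymmetric product\<close>

text \<open>
  The data are families indexed by \<open>{1..s}\<close>. Elements of \<open>\<int>/(p\<^sub>i\<^bsup>r\<^sub>i\<^esup>)\<close> are their
  representatives in \<open>{0..p\<^sub>i\<^bsup>r\<^sub>i\<^esup> - 1}\<close>, so they can be used directly as integer exponents.
\<close>

definition zring :: "(nat \<Rightarrow> nat) \<Rightarrow> (nat \<Rightarrow> nat) \<Rightarrow> nat \<Rightarrow> int ring" where
  "zring p r i = residue_ring (int (p i ^ r i))"

definition zmodule ::
    "(nat \<Rightarrow> nat) \<Rightarrow> (nat \<Rightarrow> nat) \<Rightarrow> (nat \<Rightarrow> nat) \<Rightarrow> nat \<Rightarrow> (int, nat \<Rightarrow> int) module" where
  "zmodule p r n i = free_module (zring p r i) (n i)"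

abbreviation zAut ::
    "(nat \<Rightarrow> nat) \<Rightarrow> (nat \<Rightarrow> nat) \<Rightarrow> (nat \<Rightarrow> nat) \<Rightarrow> nat \<Rightarrow> ((nat \<Rightarrow> int) \<Rightarrow> nat \<Rightarrow> int) monoid" where
  "zAut p r n i \<equiv> module_Aut (zring p r i) (zmodule p r n i)"

definition cyc_next :: "nat \<Rightarrow> nat \<Rightarrow> nat" where
  "cyc_next s i = (if i = s then 1 else i + 1)"

text \<open>
  \<open>twist \<dots> i \<mu>\<close> is \<open>f\<^sub>i\<^bsup>\<mu>\<^sub>i\<^esup> c\<^sub>i\<^bsup>\<mu>\<^sub>i\<^sub>+\<^sub>1\<^esup>\<close>, indices taken cyclically. The orders of
  \<open>f\<^sub>i\<close> and \<open>c\<^sub>i\<close> make it independent of the representatives of \<open>\<mu>\<^sub>i\<close> and \<open>\<mu>\<^sub>i\<^sub>+\<^sub>1\<close>.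
\<close>

definition twist ::
    "nat \<Rightarrow> (nat \<Rightarrow> nat) \<Rightarrow> (nat \<Rightarrow> nat) \<Rightarrow> (nat \<Rightarrow> nat)
      \<Rightarrow> (nat \<Rightarrow> (nat \<Rightarrow> int) \<Rightarrow> nat \<Rightarrow> int) \<Rightarrow> (nat \<Rightarrow> (nat \<Rightarrow> int) \<Rightarrow> nat \<Rightarrow> int)
      \<Rightarrow> nat \<Rightarrow> (nat \<Rightarrow> int) \<Rightarrow> (nat \<Rightarrow> int) \<Rightarrow> (nat \<Rightarrow> int)" where
  "twist s p r n f c i \<mu> y =
    (f i [^]\<^bsub>zAut p r n i\<^esub> \<mu> i) ((c i [^]\<^bsub>zAut p r n i\<^esub> \<mu> (cyc_next s i)) y)"

definition qval ::
    "(nat \<Rightarrow> nat) \<Rightarrow> (nat \<Rightarrow> nat) \<Rightarrow> (nat \<Rightarrow> (nat \<Rightarrow> int) \<Rightarrow> int)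
      \<Rightarrow> (nat \<Rightarrow> (nat \<Rightarrow> int) \<times> int) \<Rightarrow> nat \<Rightarrow> int" where
  "qval p r Q a i = snd (a i) \<ominus>\<^bsub>zring p r i\<^esub> Q i (fst (a i))"

definition H_add ::
    "(nat \<Rightarrow> nat) \<Rightarrow> (nat \<Rightarrow> nat) \<Rightarrow> (nat \<Rightarrow> nat) \<Rightarrow> nat \<Rightarrow> ((nat \<Rightarrow> int) \<times> int) monoid" where
  "H_add p r n i = add_monoid (zmodule p r n i) \<times>\<times> add_monoid (zring p r i)"

text \<open>
  An element \<open>(x\<^sub>1, \<mu>\<^sub>1, \<dots>, x\<^sub>s, \<mu>\<^sub>s)\<close> is the function \<open>i \<mapsto> (x\<^sub>i, \<mu>\<^sub>i)\<close> on \<open>{1..s}\<close>.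
  In the last component, the sum \<open>id + c\<^sub>s + \<dots> + c\<^sub>s\<^bsup>q - 1\<^esup>\<close> uses the least non-negative
  representative \<open>q\<close> of \<open>q\<^sub>1\<close>.
\<close>

definition matched_lambda ::
    "nat \<Rightarrow> (nat \<Rightarrow> nat) \<Rightarrow> (nat \<Rightarrow> nat) \<Rightarrow> (nat \<Rightarrow> nat) \<Rightarrow> (nat \<Rightarrow> (nat \<Rightarrow> int) \<Rightarrow> int)
      \<Rightarrow> (nat \<Rightarrow> (nat \<Rightarrow> int) \<Rightarrow> nat \<Rightarrow> int) \<Rightarrow> (nat \<Rightarrow> (nat \<Rightarrow> int) \<Rightarrow> nat \<Rightarrow> int) \<Rightarrow> (nat \<Rightarrow> int)
      \<Rightarrow> (nat \<Rightarrow> (nat \<Rightarrow> int) \<times> int) \<Rightarrow> (nat \<Rightarrow> (nat \<Rightarrow> int) \<times> int) \<Rightarrow> (nat \<Rightarrow> (nat \<Rightarrow> int) \<times> int)" where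
  "matched_lambda s p r n Q f c v a a' = (\<lambda>i\<in>{1..s}.
    let q = qval p r Q a;
        x = fst (a i);
        y = fst (a' i);
        \<mu>' = snd (a' i);
        z = twist s p r n f c i q y;
        b = polar (zring p r i) (zmodule p r n i) (Q i)
    in (z,
        if i < s then \<mu>' \<oplus>\<^bsub>zring p r i\<^esub> b x z
        else \<mu>' \<oplus>\<^bsub>zring p r i\<^esub>
               dot (zring p r i) (n i) v
                 (\<Oplus>\<^bsub>zmodule p r n i\<^esub>j\<in>{..<nat (q 1)}. (c i [^]\<^bsub>zAut p r n i\<^esub> j) y)
               \<oplus>\<^bsub>zring p r i\<^esub> b x z))"

definition matched_product ::
    "nat \<Rightarrow> (nat \<Rightarrow> nat) \<Rightarrow> (nat \<Rightarrow> nat) \<Rightarrow> (nat \<Rightarrow> nat) \<Rightarrow> (nat \<Rightarrow> (nat \<Rightarrow> int) \<Rightarrow> int)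
      \<Rightarrow> (nat \<Rightarrow> (nat \<Rightarrow> int) \<Rightarrow> nat \<Rightarrow> int) \<Rightarrow> (nat \<Rightarrow> (nat \<Rightarrow> int) \<Rightarrow> nat \<Rightarrow> int) \<Rightarrow> (nat \<Rightarrow> int)
      \<Rightarrow> (nat \<Rightarrow> (nat \<Rightarrow> int) \<times> int) ring" where
  "matched_product s p r n Q f c v =
    brace_of_lambda (product_group {1..s} (H_add p r n)) (matched_lambda s p r n Q f c v)"

definition T_brace ::
    "nat \<Rightarrow> (nat \<Rightarrow> nat) \<Rightarrow> (nat \<Rightarrow> nat) \<Rightarrow> (nat \<Rightarrow> nat) \<Rightarrow> (nat \<Rightarrow> nat \<Rightarrow> int) ring" where
  "T_brace s p r n = trivial_brace (product_group {1..s} (\<lambda>i. add_monoid (zmodule p r n i)))"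

definition S_brace :: "nat \<Rightarrow> (nat \<Rightarrow> nat) \<Rightarrow> (nat \<Rightarrow> nat) \<Rightarrow> (nat \<Rightarrow> int) ring" where
  "S_brace s p r = trivial_brace (product_group {1..s} (\<lambda>i. add_monoid (zring p r i)))"

definition alpha' ::
    "nat \<Rightarrow> (nat \<Rightarrow> nat) \<Rightarrow> (nat \<Rightarrow> nat) \<Rightarrow> (nat \<Rightarrow> nat)
      \<Rightarrow> (nat \<Rightarrow> (nat \<Rightarrow> int) \<Rightarrow> nat \<Rightarrow> int) \<Rightarrow> (nat \<Rightarrow> (nat \<Rightarrow> int) \<Rightarrow> nat \<Rightarrow> int)
      \<Rightarrow> (nat \<Rightarrow> int) \<Rightarrow> (nat \<Rightarrow> nat \<Rightarrow> int) \<Rightarrow> (nat \<Rightarrow> nat \<Rightarrow> int)" where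
  "alpha' s p r n f c \<mu> t = (\<lambda>i\<in>{1..s}. twist s p r n f c i \<mu> (t i))"

definition b' ::
    "nat \<Rightarrow> (nat \<Rightarrow> nat) \<Rightarrow> (nat \<Rightarrow> nat) \<Rightarrow> (nat \<Rightarrow> nat) \<Rightarrow> (nat \<Rightarrow> (nat \<Rightarrow> int) \<Rightarrow> int)
      \<Rightarrow> (nat \<Rightarrow> nat \<Rightarrow> int) \<Rightarrow> (nat \<Rightarrow> nat \<Rightarrow> int) \<Rightarrow> (nat \<Rightarrow> int)" where
  "b' s p r n Q t u =
    (\<lambda>i\<in>{1..s}. \<ominus>\<^bsub>zring p r i\<^esub> polar (zring p r i) (zmodule p r n i) (Q i) (t i) (u i))"

definition asym_brace ::
    "nat \<Rightarrow> (nat \<Rightarrow> nat) \<Rightarrow> (nat \<Rightarrow> nat) \<Rightarrow> (nat \<Rightarrow> nat) \<Rightarrow> (nat \<Rightarrow> (nat \<Rightarrow> int) \<Rightarrow> int)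
      \<Rightarrow> (nat \<Rightarrow> (nat \<Rightarrow> int) \<Rightarrow> nat \<Rightarrow> int) \<Rightarrow> (nat \<Rightarrow> (nat \<Rightarrow> int) \<Rightarrow> nat \<Rightarrow> int)
      \<Rightarrow> ((nat \<Rightarrow> nat \<Rightarrow> int) \<times> (nat \<Rightarrow> int)) ring" where
  "asym_brace s p r n Q f c =
    asym_product (T_brace s p r n) (S_brace s p r) (b' s p r n Q) (alpha' s p r n f c)"

definition phi' ::
    "nat \<Rightarrow> (nat \<Rightarrow> nat) \<Rightarrow> (nat \<Rightarrow> nat) \<Rightarrow> (nat \<Rightarrow> (nat \<Rightarrow> int) \<Rightarrow> int)
      \<Rightarrow> (nat \<Rightarrow> (nat \<Rightarrow> int) \<times> int) \<Rightarrow> (nat \<Rightarrow> nat \<Rightarrow> int) \<times> (nat \<Rightarrow> int)" where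
  "phi' s p r Q a =
    (\<lambda>i\<in>{1..s}. fst (a i), \<lambda>i\<in>{1..s}. snd (a i) \<ominus>\<^bsub>zring p r i\<^esub> Q i (fst (a i)))"

end

theory Submission
  imports Defs
begin

text \<open>
  The map \<open>\<phi>'\<close> is the change of variables \<open>q\<^sub>i = \<mu>\<^sub>i - Q\<^sub>i(x\<^sub>i)\<close>. It is bijective, since \<open>\<mu>\<^sub>i\<close> is recovered
  as \<open>q\<^sub>i + Q\<^sub>i(x\<^sub>i)\<close>. In the new variables the direct sum acquires the cocycle
  \<open>-(Q\<^sub>i(x + y) - Q\<^sub>i(x) - Q\<^sub>i(y)) = -b\<^sub>i(x, y)\<close>, which gives the sum of \<open>B\<close> (\<open>phi'_add\<close>), while the product becomes
  a semidirect product. The latter amounts to how a twist \<open>f\<^sub>i\<^bsup>q\<^sub>i\<^esup> c\<^sub>i\<^bsup>q\<^sub>i\<^sub>+\<^sub>1\<^esup>\<close> changes \<open>Q\<^sub>i\<close>: not at all for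
  \<open>i < s\<close>, and for \<open>i = s\<close> by the value of \<open>v\<^sub>s\<close> on the orbit sum \<open>(id + c\<^sub>s + \<dots> + c\<^sub>s\<^bsup>q\<^sub>1 - 1\<^esup>)(y)\<close>
  (\<open>Q_twist\<close>). The correction terms in the lambda map are made so that this change and
  the polar term of \<open>Q\<^sub>i(x + z)\<close> cancel (\<open>phi'_mult\<close>).

  That \<open>B\<close> is a left brace follows from three facts: the twists form an action of \<open>S'\<close>, because \<open>f\<^sub>i\<close> and \<open>c\<^sub>i\<close>
  commute and their orders divide the moduli of their exponents (\<open>twist_add_left\<close>); \<open>b'\<close> is symmetric and
  biadditive; and the twists preserve \<open>b'\<close> (\<open>twist_polar\<close>). For \<open>c\<^sub>s\<close>, which need not preserve \<open>Q\<^sub>s\<close>, the last point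
  holds because \<open>Q\<^sub>s\<close> changes by an additive map, and the polar form does not see such a change. The matched
  product inherits the brace axioms from \<open>B\<close> through \<open>\<phi>'\<close> (\<open>left_brace_transport\<close>), so they need not be
  checked on the lambda map.
\<close>

section \<open>Left braces from lambda maps and asymmetric products\<close>

lemma brace_of_lambda_simps [simp]:
  "carrier (brace_of_lambda A L) = carrier A"
  "x \<oplus>\<^bsub>brace_of_lambda A L\<^esub> y = x \<otimes>\<^bsub>A\<^esub> y"
  "x \<otimes>\<^bsub>brace_of_lambda A L\<^esub> y = x \<otimes>\<^bsub>A\<^esub> L x y"
  "\<zero>\<^bsub>brace_of_lambda A L\<^esub> = \<one>\<^bsub>A\<^esub>"
  "\<one>\<^bsub>brace_of_lambda A L\<^esub> = \<one>\<^bsub>A\<^esub>"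
  by (simp_all add: brace_of_lambda_def)

lemma trivial_brace_simps [simp]:
  "carrier (trivial_brace A) = carrier A"
  "x \<oplus>\<^bsub>trivial_brace A\<^esub> y = x \<otimes>\<^bsub>A\<^esub> y"
  "x \<otimes>\<^bsub>trivial_brace A\<^esub> y = x \<otimes>\<^bsub>A\<^esub> y"
  "\<zero>\<^bsub>trivial_brace A\<^esub> = \<one>\<^bsub>A\<^esub>"
  "\<one>\<^bsub>trivial_brace A\<^esub> = \<one>\<^bsub>A\<^esub>"
  by (simp_all add: trivial_brace_def)

lemma asym_product_simps [simp]:
  "carrier (asym_product T S \<beta> \<alpha>) = carrier T \<times> carrier S"
  "(t, x) \<oplus>\<^bsub>asym_product T S \<beta> \<alpha>\<^esub> (u, y) = (t \<oplus>\<^bsub>T\<^esub> u, x \<oplus>\<^bsub>S\<^esub> y \<oplus>\<^bsub>S\<^esub> \<beta> t u)"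
  "(t, x) \<otimes>\<^bsub>asym_product T S \<beta> \<alpha>\<^esub> (u, y) = (t \<otimes>\<^bsub>T\<^esub> \<alpha> x u, x \<otimes>\<^bsub>S\<^esub> y)"
  "\<zero>\<^bsub>asym_product T S \<beta> \<alpha>\<^esub> = (\<zero>\<^bsub>T\<^esub>, \<zero>\<^bsub>S\<^esub>)"
  "\<one>\<^bsub>asym_product T S \<beta> \<alpha>\<^esub> = (\<one>\<^bsub>T\<^esub>, \<one>\<^bsub>S\<^esub>)"
  by (simp_all add: asym_product_def)

text \<open>
  The brace identity at \<open>a = 1\<close>, \<open>b = c = 0\<close> reads \<open>1 = 0\<close>. Hence an additive bijection from
  a structure with \<open>1 = 0\<close> onto a left brace also respects the multiplicative identity.
\<close>

lemma (in left_brace) one_eq_zero: "\<one> = \<zero>"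
proof -
  have "\<one> \<otimes> (\<zero> \<oplus> \<zero>) \<oplus> \<one> = \<one> \<otimes> \<zero> \<oplus> \<one> \<otimes> \<zero>"
    by (rule brace_compat) auto
  then show ?thesis
    by simp
qed

text \<open>
  Every axiom can be tested after applying the bijection \<open>h\<close>. Closure of \<open>L\<close> has to be assumed, because
  \<open>brace_iso\<close> only speaks of the images of sums and products.
\<close>

lemma left_brace_transport:
  assumes A: "group A"
    and L: "\<And>a b. \<lbrakk>a \<in> carrier A; b \<in> carrier A\<rbrakk> \<Longrightarrow> L a b \<in> carrier A"
    and C: "left_brace C"
    and h: "h \<in> brace_iso (brace_of_lambda A L) C"
  shows "left_brace (brace_of_lambda A L)"
proof -
  interpret A: group A by fact
  interpret C: left_brace C by fact
  let ?B = "brace_of_lambda A L"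
  have add: "h (x \<otimes>\<^bsub>A\<^esub> y) = h x \<oplus>\<^bsub>C\<^esub> h y"
    and mult: "h (x \<otimes>\<^bsub>A\<^esub> L x y) = h x \<otimes>\<^bsub>C\<^esub> h y"
    if "x \<in> carrier A" "y \<in> carrier A" for x y
    using h that by (auto simp: brace_iso_def)
  have bij: "bij_betw h (carrier A) (carrier C)"
    using h by (auto simp: brace_iso_def)
  have hc [simp]: "h x \<in> carrier C" if "x \<in> carrier A" for x
    using bij that by (auto dest: bij_betwE)
  have inj: "x = y" if "h x = h y" "x \<in> carrier A" "y \<in> carrier A" for x y
    using bij that by (auto simp: bij_betw_def inj_on_def)
  have surj: "\<exists>x\<in>carrier A. h x = z" if "z \<in> carrier C" for z
    using bij_betw_imp_surj_on[OF bij] that by (metis imageE)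
  have Lc [simp]: "x \<otimes>\<^bsub>A\<^esub> L x y \<in> carrier A" if "x \<in> carrier A" "y \<in> carrier A" for x y
    using L that by simp
  have one: "h \<one>\<^bsub>A\<^esub> = \<zero>\<^bsub>C\<^esub>"
    using add[of "\<one>\<^bsub>A\<^esub>" "\<one>\<^bsub>A\<^esub>"] hc[of "\<one>\<^bsub>A\<^esub>"] by (simp del: hc)
  have one': "h \<one>\<^bsub>A\<^esub> = \<one>\<^bsub>C\<^esub>"
    using one C.one_eq_zero by simp
  have "abelian_group ?B"
  proof (rule abelian_groupI, goal_cases)
    case (4 x y)
    then show ?case
      by (intro inj) (simp_all add: add C.add.m_comm)
  next
    case (6 x)
    then show ?case by (auto intro!: bexI[of _ "inv\<^bsub>A\<^esub> x"])
  qed (auto simp: A.m_assoc)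
  moreover have "group ?B"
  proof (rule groupI, goal_cases)
    case (3 x y z)
    then show ?case
      by (intro inj) (simp_all add: mult C.m_assoc)
  next
    case (4 x)
    then show ?case
      by (intro inj) (simp_all add: mult one')
  next
    case (5 x)
    then obtain y where "y \<in> carrier A" "h y = inv\<^bsub>C\<^esub> (h x)"
      using surj[of "inv\<^bsub>C\<^esub> (h x)"] by auto
    with 5 show ?case
      by (intro bexI[of _ y] inj) (simp_all add: mult one')
  qed auto
  moreover have "left_brace_axioms ?B"
  proof (rule left_brace_axioms.intro, goal_cases)
    case (1 a b c)
    then show ?case
      by (intro inj) (simp_all add: mult add C.brace_compat)
  qed
  ultimately show ?thesis
    by (rule left_brace.intro)
qed

text \<open>
  The sum is that of a central extension of \<open>A\<close> by \<open>C\<close> with a symmetric bilinear cocycle, so it gives an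
  abelian group; the product is a semidirect product. In the brace identity the \<open>A\<close>-parts agree because
  \<open>\<alpha>\<close> acts by homomorphisms, and the \<open>C\<close>-parts agree after expanding \<open>\<beta>\<close> bilinearly, where the one term
  without a partner on the other side, \<open>\<beta> (\<alpha> x t) (\<alpha> x u)\<close>, equals \<open>\<beta> t u\<close> by invariance.
\<close>

lemma left_brace_asym_product_trivial:
  assumes A: "comm_group A" and C: "comm_group C"
    and \<beta>_closed: "\<And>t u. \<lbrakk>t \<in> carrier A; u \<in> carrier A\<rbrakk> \<Longrightarrow> \<beta> t u \<in> carrier C"
    and \<beta>_sym: "\<And>t u. \<lbrakk>t \<in> carrier A; u \<in> carrier A\<rbrakk> \<Longrightarrow> \<beta> t u = \<beta> u t"
    and \<beta>_mult: "\<And>t u w. \<lbrakk>t \<in> carrier A; u \<in> carrier A; w \<in> carrier A\<rbrakk>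
      \<Longrightarrow> \<beta> (t \<otimes>\<^bsub>A\<^esub> u) w = \<beta> t w \<otimes>\<^bsub>C\<^esub> \<beta> u w"
    and \<alpha>_hom: "\<And>x. x \<in> carrier C \<Longrightarrow> \<alpha> x \<in> hom A A"
    and \<alpha>_one: "\<And>t. t \<in> carrier A \<Longrightarrow> \<alpha> \<one>\<^bsub>C\<^esub> t = t"
    and \<alpha>_mult: "\<And>x y t. \<lbrakk>x \<in> carrier C; y \<in> carrier C; t \<in> carrier A\<rbrakk>
      \<Longrightarrow> \<alpha> (x \<otimes>\<^bsub>C\<^esub> y) t = \<alpha> x (\<alpha> y t)"
    and \<alpha>_\<beta>: "\<And>x t u. \<lbrakk>x \<in> carrier C; t \<in> carrier A; u \<in> carrier A\<rbrakk>
      \<Longrightarrow> \<beta> (\<alpha> x t) (\<alpha> x u) = \<beta> t u"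
  shows "left_brace (asym_product (trivial_brace A) (trivial_brace C) \<beta> \<alpha>)"
proof -
  interpret A: comm_group A by fact
  interpret C: comm_group C by fact
  let ?B = "asym_product (trivial_brace A) (trivial_brace C) \<beta> \<alpha>"
  note [simp] = \<beta>_closed \<beta>_mult \<alpha>_one \<alpha>_mult \<alpha>_\<beta>
  have \<alpha>_closed [simp]: "\<alpha> x t \<in> carrier A" if "x \<in> carrier C" "t \<in> carrier A" for x t
    using \<alpha>_hom that by (auto simp: hom_def)
  have \<alpha>_add [simp]: "\<alpha> x (t \<otimes>\<^bsub>A\<^esub> u) = \<alpha> x t \<otimes>\<^bsub>A\<^esub> \<alpha> x u"
    if "x \<in> carrier C" "t \<in> carrier A" "u \<in> carrier A" for x t u
    using \<alpha>_hom that by (auto simp: hom_def)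
  have \<alpha>_fix_one: "\<alpha> x \<one>\<^bsub>A\<^esub> = \<one>\<^bsub>A\<^esub>" if "x \<in> carrier C" for x
    using \<alpha>_hom[OF that] A.is_group by (intro hom_one) auto
  have \<beta>_mult' [simp]: "\<beta> w (t \<otimes>\<^bsub>A\<^esub> u) = \<beta> w t \<otimes>\<^bsub>C\<^esub> \<beta> w u"
    if "t \<in> carrier A" "u \<in> carrier A" "w \<in> carrier A" for t u w
    using that by (simp add: \<beta>_sym[of w])
  have \<beta>_one [simp]: "\<beta> \<one>\<^bsub>A\<^esub> t = \<one>\<^bsub>C\<^esub>" if "t \<in> carrier A" for t
    using that \<beta>_mult[OF A.one_closed A.one_closed that] by (simp del: \<beta>_mult)
  have \<beta>_inv: "\<beta> (inv\<^bsub>A\<^esub> t) t \<otimes>\<^bsub>C\<^esub> \<beta> t t = \<one>\<^bsub>C\<^esub>" if "t \<in> carrier A" for t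
    using that \<beta>_mult[of "inv\<^bsub>A\<^esub> t" t t] by simp
  have "abelian_group ?B"
  proof (rule abelian_groupI, goal_cases)
    case (3 x y z)
    then show ?case by (auto simp: A.m_ac C.m_ac)
  next
    case (4 x y)
    then show ?case by (auto simp: A.m_ac C.m_ac \<beta>_sym)
  next
    case (6 a)
    then obtain t x where a: "a = (t, x)" "t \<in> carrier A" "x \<in> carrier C"
      by auto
    \<comment> \<open>the factor \<open>\<beta> t t\<close> in the negative of \<open>a\<close> compensates the cocycle term \<open>\<beta> (inv t) t\<close>\<close>
    have "inv\<^bsub>C\<^esub> x \<otimes>\<^bsub>C\<^esub> \<beta> t t \<otimes>\<^bsub>C\<^esub> x \<otimes>\<^bsub>C\<^esub> \<beta> (inv\<^bsub>A\<^esub> t) t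
        = (inv\<^bsub>C\<^esub> x \<otimes>\<^bsub>C\<^esub> x) \<otimes>\<^bsub>C\<^esub> (\<beta> (inv\<^bsub>A\<^esub> t) t \<otimes>\<^bsub>C\<^esub> \<beta> t t)"
      using a by (simp only: C.m_ac C.m_closed C.inv_closed \<beta>_closed A.inv_closed)
    also have "\<dots> = \<one>\<^bsub>C\<^esub>"
      using a by (simp add: \<beta>_inv)
    finally show ?case
      using a by (intro bexI[of _ "(inv\<^bsub>A\<^esub> t, inv\<^bsub>C\<^esub> x \<otimes>\<^bsub>C\<^esub> \<beta> t t)"]) auto
  qed auto
  moreover have "group ?B"
  proof (rule groupI, goal_cases)
    case (3 x y z)
    then show ?case by (auto simp: A.m_assoc C.m_assoc)
  next
    case (5 a)
    then obtain t x where a: "a = (t, x)" "t \<in> carrier A" "x \<in> carrier C"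
      by auto
    \<comment> \<open>the inverse in a semidirect product\<close>
    define u where "u = \<alpha> (inv\<^bsub>C\<^esub> x) (inv\<^bsub>A\<^esub> t)"
    have "u \<in> carrier A"
      using a by (simp add: u_def)
    have "u \<otimes>\<^bsub>A\<^esub> \<alpha> (inv\<^bsub>C\<^esub> x) t = \<alpha> (inv\<^bsub>C\<^esub> x) (inv\<^bsub>A\<^esub> t \<otimes>\<^bsub>A\<^esub> t)"
      using a unfolding u_def by (simp only: \<alpha>_add A.inv_closed C.inv_closed)
    also have "\<dots> = \<one>\<^bsub>A\<^esub>"
      using a \<alpha>_fix_one by simp
    finally have "(u, inv\<^bsub>C\<^esub> x) \<otimes>\<^bsub>?B\<^esub> a = \<one>\<^bsub>?B\<^esub>"
      unfolding a(1) using a(3) by (simp only: asym_product_simps trivial_brace_simps C.l_inv)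
    moreover have "(u, inv\<^bsub>C\<^esub> x) \<in> carrier ?B"
      using a(3) \<open>u \<in> carrier A\<close> by simp
    ultimately show ?case
      by (rule bexI)
  qed auto
  moreover have "left_brace_axioms ?B"
  proof (rule left_brace_axioms.intro, goal_cases)
    case (1 a b c)
    then show ?case
      by (auto simp: A.m_ac C.m_ac \<beta>_sym)
  qed
  ultimately show ?thesis
    by (rule left_brace.intro)
qed

section \<open>Free modules and their automorphism groups\<close>

lemma comm_group_product_group:
  assumes "\<And>i. i \<in> I \<Longrightarrow> comm_group (G i)"
  shows "comm_group (product_group I G)"
proof (rule group.group_comm_groupI)
  show "group (product_group I G)"
    using assms by (simp add: comm_group.axioms)
  fix x y
  assume "x \<in> carrier (product_group I G)" "y \<in> carrier (product_group I G)"
  then show "x \<otimes>\<^bsub>product_group I G\<^esub> y = y \<otimes>\<^bsub>product_group I G\<^esub> x"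
    using assms
    by (auto simp: PiE_iff comm_group_def comm_monoid.m_comm intro!: restrict_ext)
qed

lemma free_module_simps [simp]:
  "carrier (free_module R n) = {1..n} \<rightarrow>\<^sub>E carrier R"
  "x \<oplus>\<^bsub>free_module R n\<^esub> y = (\<lambda>j\<in>{1..n}. x j \<oplus>\<^bsub>R\<^esub> y j)"
  "\<zero>\<^bsub>free_module R n\<^esub> = (\<lambda>j\<in>{1..n}. \<zero>\<^bsub>R\<^esub>)"
  "a \<odot>\<^bsub>free_module R n\<^esub> x = (\<lambda>j\<in>{1..n}. a \<otimes>\<^bsub>R\<^esub> x j)"
  by (simp_all add: free_module_def)

lemma (in cring) module_free_module: "module R (free_module R n)"
proof (rule moduleI)
  show "abelian_group (free_module R n)"
  proof (rule abelian_groupI, goal_cases)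
    case (6 x)
    then show ?case
      by (auto simp: PiE_iff l_neg intro!: bexI[of _ "\<lambda>j\<in>{1..n}. \<ominus> x j"])
  qed (auto simp: PiE_iff a_ac extensional_def fun_eq_iff)
qed (auto simp: PiE_iff l_distr r_distr m_assoc is_cring extensional_def fun_eq_iff)

lemma (in cring) dot_closed [simp]:
  assumes "v \<in> carrier (free_module R n)" "x \<in> carrier (free_module R n)"
  shows "dot R n v x \<in> carrier R"
  using assms unfolding dot_def by (intro finsum_closed) (auto simp: PiE_iff)

lemma (in cring) dot_add:
  assumes v: "v \<in> carrier (free_module R n)"
    and x: "x \<in> carrier (free_module R n)" and y: "y \<in> carrier (free_module R n)"
  shows "dot R n v (x \<oplus>\<^bsub>free_module R n\<^esub> y) = dot R n v x \<oplus> dot R n v y"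
proof -
  have "dot R n v (x \<oplus>\<^bsub>free_module R n\<^esub> y) = (\<Oplus>j\<in>{1..n}. v j \<otimes> x j \<oplus> v j \<otimes> y j)"
    unfolding dot_def using assms by (intro finsum_cong') (auto simp: PiE_iff r_distr)
  also have "\<dots> = dot R n v x \<oplus> dot R n v y"
    unfolding dot_def using assms by (intro finsum_addf) (auto simp: PiE_iff)
  finally show ?thesis .
qed

lemma module_Aut_iff:
  "g \<in> carrier (module_Aut R M) \<longleftrightarrow>
     g \<in> extensional (carrier M) \<and> bij_betw g (carrier M) (carrier M) \<and>
     (\<forall>x\<in>carrier M. \<forall>y\<in>carrier M. g (x \<oplus>\<^bsub>M\<^esub> y) = g x \<oplus>\<^bsub>M\<^esub> g y) \<and>
     (\<forall>a\<in>carrier R. \<forall>x\<in>carrier M. g (a \<odot>\<^bsub>M\<^esub> x) = a \<odot>\<^bsub>M\<^esub> g x)"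
  by (auto simp: module_Aut_def auto_def hom_def Bij_def bij_betw_def)

lemma one_module_Aut: "\<one>\<^bsub>module_Aut R M\<^esub> = (\<lambda>x\<in>carrier M. x)"
  by (simp add: module_Aut_def AutoGroup_def BijGroup_def)

lemma mult_module_Aut:
  assumes "g \<in> carrier (module_Aut R M)" "h \<in> carrier (module_Aut R M)"
  shows "g \<otimes>\<^bsub>module_Aut R M\<^esub> h = compose (carrier M) g h"
  using assms by (simp add: module_Aut_def AutoGroup_def BijGroup_def auto_def)

lemma module_Aut_closed:
  "\<lbrakk>g \<in> carrier (module_Aut R M); x \<in> carrier M\<rbrakk> \<Longrightarrow> g x \<in> carrier M"
  by (auto simp: module_Aut_iff dest: bij_betwE)

context module
begin

lemma group_module_Aut: "group (module_Aut R M)"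
proof -
  have A: "group (AutoGroup (add_monoid M))"
    by (rule group.AutoGroup) (rule M.a_group)
  interpret A: group "AutoGroup (add_monoid M)" by (rule A)
  have carr: "carrier (AutoGroup (add_monoid M)) = auto (add_monoid M)"
    by (simp add: AutoGroup_def)
  have "subgroup (carrier (module_Aut R M)) (AutoGroup (add_monoid M))"
  proof (rule A.subgroupI)
    show "carrier (module_Aut R M) \<subseteq> carrier (AutoGroup (add_monoid M))"
      by (auto simp: module_Aut_def AutoGroup_def)
    have "\<one>\<^bsub>module_Aut R M\<^esub> \<in> carrier (module_Aut R M)"
      by (auto simp: one_module_Aut module_Aut_iff bij_betw_def)
    then show "carrier (module_Aut R M) \<noteq> {}"
      by blast
  next
    fix g h
    assume gh: "g \<in> carrier (module_Aut R M)" "h \<in> carrier (module_Aut R M)"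
    have "compose (carrier M) g h \<in> carrier (module_Aut R M)"
      using gh by (auto simp: module_Aut_iff compose_def bij_betw_apply intro: bij_betw_trans[unfolded comp_def])
    moreover have "g \<otimes>\<^bsub>AutoGroup (add_monoid M)\<^esub> h = g \<otimes>\<^bsub>module_Aut R M\<^esub> h"
      by (simp add: module_Aut_def)
    ultimately show "g \<otimes>\<^bsub>AutoGroup (add_monoid M)\<^esub> h \<in> carrier (module_Aut R M)"
      using gh by (simp add: mult_module_Aut)
  next
    fix g
    assume g: "g \<in> carrier (module_Aut R M)"
    define g' where "g' = inv\<^bsub>AutoGroup (add_monoid M)\<^esub> g"
    have gA: "g \<in> carrier (AutoGroup (add_monoid M))"
      using g by (simp add: module_Aut_def AutoGroup_def)
    then have g'A: "g' \<in> auto (add_monoid M)"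
      unfolding g'_def carr[symmetric] by (rule A.inv_closed)
    have cl: "g' x \<in> carrier M" if "x \<in> carrier M" for x
      using g'A that by (auto simp: auto_def hom_def)
    have id: "g (g' x) = x" "g' (g x) = x" if "x \<in> carrier M" for x
    proof -
      have "g \<otimes>\<^bsub>AutoGroup (add_monoid M)\<^esub> g' = \<one>\<^bsub>AutoGroup (add_monoid M)\<^esub>"
        "g' \<otimes>\<^bsub>AutoGroup (add_monoid M)\<^esub> g = \<one>\<^bsub>AutoGroup (add_monoid M)\<^esub>"
        using gA unfolding g'_def by simp_all
      then have "compose (carrier M) g g' = (\<lambda>x\<in>carrier M. x)"
        "compose (carrier M) g' g = (\<lambda>x\<in>carrier M. x)"
        using g'A gA by (simp_all add: AutoGroup_def BijGroup_def auto_def)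
      from fun_cong[OF this(1), of x] fun_cong[OF this(2), of x] show "g (g' x) = x" "g' (g x) = x"
        using that by (simp_all add: compose_def)
    qed
    have "g' (a \<odot>\<^bsub>M\<^esub> x) = a \<odot>\<^bsub>M\<^esub> g' x" if "a \<in> carrier R" "x \<in> carrier M" for a x
    proof -
      have "g' (a \<odot>\<^bsub>M\<^esub> x) = g' (a \<odot>\<^bsub>M\<^esub> g (g' x))"
        using that id by simp
      also have "\<dots> = g' (g (a \<odot>\<^bsub>M\<^esub> g' x))"
        using g that cl by (simp add: module_Aut_iff)
      finally show ?thesis
        using that cl id by simp
    qed
    then show "inv\<^bsub>AutoGroup (add_monoid M)\<^esub> g \<in> carrier (module_Aut R M)"
      using g'A unfolding g'_def[symmetric] by (simp add: module_Aut_def)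
  qed
  from subgroup.subgroup_is_group[OF this A] show ?thesis
    by (simp add: module_Aut_def)
qed

lemma group_orthogonal_group: "group (orthogonal_group R M Q)"
proof -
  interpret G: group "module_Aut R M" by (rule group_module_Aut)
  have "subgroup (carrier (orthogonal_group R M Q)) (module_Aut R M)"
  proof (rule G.subgroupI)
    show "carrier (orthogonal_group R M Q) \<subseteq> carrier (module_Aut R M)"
      by (auto simp: orthogonal_group_def)
    have "\<one>\<^bsub>module_Aut R M\<^esub> \<in> carrier (orthogonal_group R M Q)"
      using G.one_closed by (simp add: orthogonal_group_def) (simp add: one_module_Aut)
    then show "carrier (orthogonal_group R M Q) \<noteq> {}"
      by blast
  next
    fix g h
    assume gh: "g \<in> carrier (orthogonal_group R M Q)" "h \<in> carrier (orthogonal_group R M Q)"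
    then have "g \<otimes>\<^bsub>module_Aut R M\<^esub> h \<in> carrier (module_Aut R M)"
      by (intro G.m_closed) (auto simp: orthogonal_group_def)
    with gh show "g \<otimes>\<^bsub>module_Aut R M\<^esub> h \<in> carrier (orthogonal_group R M Q)"
      by (auto simp: orthogonal_group_def mult_module_Aut compose_def module_Aut_closed)
  next
    fix g
    assume g: "g \<in> carrier (orthogonal_group R M Q)"
    then have gQ: "Q (g x) = Q x" if "x \<in> carrier M" for x
      using that by (auto simp: orthogonal_group_def)
    have gG: "g \<in> carrier (module_Aut R M)"
      using g by (simp add: orthogonal_group_def)
    define g' where "g' = inv\<^bsub>module_Aut R M\<^esub> g"
    have g': "g' \<in> carrier (module_Aut R M)"
      using gG by (simp add: g'_def)
    have "Q (g' x) = Q x" if "x \<in> carrier M" for x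
    proof -
      have "compose (carrier M) g g' = \<one>\<^bsub>module_Aut R M\<^esub>"
        using gG g' by (simp add: mult_module_Aut[symmetric] g'_def)
      from fun_cong[OF this, of x] that have "g (g' x) = x"
        by (simp add: compose_def one_module_Aut)
      with gQ[of "g' x"] g' that show ?thesis
        by (simp add: module_Aut_closed)
    qed
    with g' show "inv\<^bsub>module_Aut R M\<^esub> g \<in> carrier (orthogonal_group R M Q)"
      by (simp add: orthogonal_group_def g'_def)
  qed
  from subgroup.subgroup_is_group[OF this group_module_Aut] show ?thesis
    by (simp add: orthogonal_group_def)
qed

end

lemma module_Aut_mult_apply:
  assumes "g \<in> carrier (module_Aut R M)" "h \<in> carrier (module_Aut R M)" "x \<in> carrier M"
  shows "(g \<otimes>\<^bsub>module_Aut R M\<^esub> h) x = g (h x)"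
  using assms by (simp add: mult_module_Aut compose_def)

text \<open>
  Transfers the orders given in the orthogonal group to the powers in the twist, which are formed in the
  automorphism group.
\<close>

lemma nat_pow_orthogonal_group:
  "g [^]\<^bsub>orthogonal_group R M Q\<^esub> (k :: nat) = g [^]\<^bsub>module_Aut R M\<^esub> k"
  by (induction k) (simp_all add: orthogonal_group_def)

section \<open>Subtraction in abelian groups and powers in groups\<close>

lemma (in abelian_group) minus_eqI:
  assumes "d \<oplus> u = m" "d \<in> carrier G" "u \<in> carrier G"
  shows "m \<ominus> u = d"
  using assms by (auto simp: minus_eq a_assoc r_neg)

lemma (in abelian_group) minus_add_cancel:
  assumes "m \<in> carrier G" "u \<in> carrier G"
  shows "m \<ominus> u \<oplus> u = m"
  using assms by (simp add: minus_eq a_assoc l_neg)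

lemma (in abelian_group) minus_minus_cong:
  assumes [simp]: "m \<in> carrier G" "m' \<in> carrier G" "u \<in> carrier G" "u' \<in> carrier G"
    "\<beta> \<in> carrier G"
  shows "m \<oplus> m' \<ominus> (u \<oplus> u' \<oplus> \<beta>) = m \<ominus> u \<oplus> (m' \<ominus> u') \<oplus> \<ominus> \<beta>"
proof (rule minus_eqI)
  have "m \<ominus> u \<oplus> (m' \<ominus> u') \<oplus> \<ominus> \<beta> \<oplus> (u \<oplus> u' \<oplus> \<beta>)
      = (m \<ominus> u \<oplus> u) \<oplus> (m' \<ominus> u' \<oplus> u') \<oplus> (\<ominus> \<beta> \<oplus> \<beta>)"
    by (simp only: a_ac a_closed minus_closed a_inv_closed assms)
  then show "m \<ominus> u \<oplus> (m' \<ominus> u') \<oplus> \<ominus> \<beta> \<oplus> (u \<oplus> u' \<oplus> \<beta>) = m \<oplus> m'"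
    by (simp add: minus_add_cancel l_neg)
qed simp_all

text \<open>
  Exponents in \<open>\<int>/(m)\<close> are added modulo \<open>m\<close>; this does not change powers of elements whose order divides \<open>m\<close>.
\<close>

lemma (in group) int_pow_add_mod:
  assumes g: "g \<in> carrier G" and m: "g [^] (m :: nat) = \<one>"
  shows "g [^] ((i + j) mod int m) = g [^] i \<otimes> g [^] j"
proof -
  have "g [^] (i + j) = g [^] (int m * ((i + j) div int m) + (i + j) mod int m)"
    by simp
  also have "\<dots> = (g [^] int m) [^] ((i + j) div int m) \<otimes> g [^] ((i + j) mod int m)"
    using g by (simp only: int_pow_mult int_pow_pow)
  also have "\<dots> = g [^] ((i + j) mod int m)"
    using g m by (simp add: int_pow_int)
  finally show ?thesis
    using g by (simp add: int_pow_mult)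
qed

lemma (in group) int_pow_commute:
  assumes "g \<otimes> h = h \<otimes> g" "g \<in> carrier G" "h \<in> carrier G" "0 \<le> i" "0 \<le> j"
  shows "g [^] (i :: int) \<otimes> h [^] (j :: int) = h [^] j \<otimes> g [^] i"
proof -
  have gh: "g [^] nat i \<otimes> h = h \<otimes> g [^] nat i"
    using assms(1-3) by (rule group_commutes_pow)
  have "h [^] nat j \<otimes> g [^] nat i = g [^] nat i \<otimes> h [^] nat j"
    by (rule group_commutes_pow[OF gh[symmetric] assms(3) nat_pow_closed[OF assms(2)]])
  with \<open>0 \<le> i\<close> \<open>0 \<le> j\<close> show ?thesis
    by (simp only: int_pow_def2 not_less[symmetric] if_False)
qed

section \<open>Automorphisms that change a quadratic form by an additive map\<close>

locale quadratic_module = module R M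
  for R (structure) and M (structure) +
  fixes Q
  assumes quadratic: "quadratic_form R M Q"
begin

abbreviation b where "b \<equiv> polar R M Q"

lemma Q_closed [simp]: "x \<in> carrier M \<Longrightarrow> Q x \<in> carrier R"
  using quadratic by (simp add: quadratic_form_def)

lemma polar_closed [simp]: "\<lbrakk>x \<in> carrier M; y \<in> carrier M\<rbrakk> \<Longrightarrow> b x y \<in> carrier R"
  using quadratic by (simp add: quadratic_form_def bilinear_form_def)

lemma polar_add:
  "\<lbrakk>x \<in> carrier M; y \<in> carrier M; z \<in> carrier M\<rbrakk> \<Longrightarrow> b (x \<oplus>\<^bsub>M\<^esub> y) z = b x z \<oplus> b y z"
  using quadratic by (simp add: quadratic_form_def bilinear_form_def)

lemma polar_sym: "\<lbrakk>x \<in> carrier M; y \<in> carrier M\<rbrakk> \<Longrightarrow> b x y = b y x"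
  unfolding polar_def by (simp add: M.a_comm R.minus_eq R.a_ac)

lemma Q_add:
  assumes "x \<in> carrier M" "y \<in> carrier M"
  shows "Q (x \<oplus>\<^bsub>M\<^esub> y) = Q x \<oplus> Q y \<oplus> b x y"
proof -
  have "Q x \<oplus> Q y \<oplus> b x y = (Q (x \<oplus>\<^bsub>M\<^esub> y) \<ominus> Q x \<ominus> Q y \<oplus> Q y) \<oplus> Q x"
    using assms unfolding polar_def
    by (simp only: R.a_ac R.a_closed R.minus_closed Q_closed M.a_closed)
  then show ?thesis
    using assms by (simp add: R.minus_add_cancel)
qed

text \<open>
  The polar form is the defect of additivity of \<open>Q\<close>, so it does not see an additive change of \<open>Q\<close>. This
  covers the elements of the orthogonal group (\<open>l = 0\<close>) and the automorphism \<open>c\<^sub>s\<close>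
  (\<open>l\<close> is the product with \<open>v\<^sub>s\<close>).
\<close>

lemma polar_eq_if_Q_shift:
  assumes g: "g \<in> carrier (module_Aut R M)"
    and l_closed: "\<And>x. x \<in> carrier M \<Longrightarrow> l x \<in> carrier R"
    and l_add: "\<And>x y. \<lbrakk>x \<in> carrier M; y \<in> carrier M\<rbrakk> \<Longrightarrow> l (x \<oplus>\<^bsub>M\<^esub> y) = l x \<oplus> l y"
    and Q_g: "\<And>x. x \<in> carrier M \<Longrightarrow> Q (g x) = Q x \<oplus> l x"
    and x: "x \<in> carrier M" and y: "y \<in> carrier M"
  shows "b (g x) (g y) = b x y"
proof -
  note closed = x y l_closed[OF x] l_closed[OF y] module_Aut_closed[OF g x] module_Aut_closed[OF g y]
  have "Q (g x) \<oplus> Q (g y) \<oplus> b (g x) (g y) = Q (g (x \<oplus>\<^bsub>M\<^esub> y))"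
    using g closed by (simp add: Q_add module_Aut_iff)
  also have "\<dots> = (Q x \<oplus> Q y \<oplus> b x y) \<oplus> (l x \<oplus> l y)"
    using closed by (simp add: Q_g Q_add l_add)
  also have "\<dots> = Q (g x) \<oplus> Q (g y) \<oplus> b x y"
    using closed by (simp add: Q_g R.a_ac)
  finally show ?thesis
    using closed by simp
qed

lemma polar_pow:
  assumes g: "g \<in> carrier (module_Aut R M)"
    and inv: "\<And>x y. \<lbrakk>x \<in> carrier M; y \<in> carrier M\<rbrakk> \<Longrightarrow> b (g x) (g y) = b x y"
    and "x \<in> carrier M" "y \<in> carrier M"
  shows "b ((g [^]\<^bsub>module_Aut R M\<^esub> (k :: nat)) x) ((g [^]\<^bsub>module_Aut R M\<^esub> k) y) = b x y"
proof -
  interpret G: group "module_Aut R M" by (rule group_module_Aut)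
  show ?thesis
    using assms(3,4)
  proof (induction k arbitrary: x y)
    case 0
    then show ?case by (simp add: one_module_Aut)
  next
    case (Suc k)
    then show ?case
      using g by (simp add: module_Aut_mult_apply module_Aut_closed inv)
  qed
qed

text \<open>
  Iterating \<open>Q (g x) = Q x + l x\<close> adds the values of \<open>l\<close> along the orbit \<open>x, g x, \<dots>\<close>; this is where the sum
  \<open>id + c\<^sub>s + \<dots> + c\<^sub>s\<^bsup>q - 1\<^esup>\<close> in the lambda map comes from.
\<close>

lemma Q_pow_shift:
  assumes g: "g \<in> carrier (module_Aut R M)"
    and l_closed: "\<And>x. x \<in> carrier M \<Longrightarrow> l x \<in> carrier R"
    and l_add: "\<And>x y. \<lbrakk>x \<in> carrier M; y \<in> carrier M\<rbrakk> \<Longrightarrow> l (x \<oplus>\<^bsub>M\<^esub> y) = l x \<oplus> l y"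
    and Q_g: "\<And>x. x \<in> carrier M \<Longrightarrow> Q (g x) = Q x \<oplus> l x"
    and x: "x \<in> carrier M"
  shows "Q ((g [^]\<^bsub>module_Aut R M\<^esub> (k :: nat)) x)
    = Q x \<oplus> l (\<Oplus>\<^bsub>M\<^esub>j\<in>{..<k}. (g [^]\<^bsub>module_Aut R M\<^esub> j) x)"
proof -
  interpret G: group "module_Aut R M" by (rule group_module_Aut)
  have pow_closed: "(g [^]\<^bsub>module_Aut R M\<^esub> (j :: nat)) x \<in> carrier M" for j
    by (rule module_Aut_closed[OF G.nat_pow_closed[OF g] x])
  show ?thesis
  proof (induction k)
    case 0
    have l0: "l \<zero>\<^bsub>M\<^esub> \<in> carrier R"
      by (rule l_closed) simp
    have "l \<zero>\<^bsub>M\<^esub> = l \<zero>\<^bsub>M\<^esub> \<oplus> l \<zero>\<^bsub>M\<^esub>"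
      using l_add[OF M.zero_closed M.zero_closed] by (simp only: M.l_zero M.zero_closed)
    then have "l \<zero>\<^bsub>M\<^esub> = \<zero>"
      using R.add.l_cancel_one'[OF l0 l0] by (rule iffD1[rotated])
    then show ?case
      using x by (simp add: one_module_Aut)
  next
    case (Suc k)
    let ?y = "(g [^]\<^bsub>module_Aut R M\<^esub> k) x" and ?S = "\<Oplus>\<^bsub>M\<^esub>j\<in>{..<k}. (g [^]\<^bsub>module_Aut R M\<^esub> j) x"
    have S: "?S \<in> carrier M"
      using pow_closed by (intro M.finsum_closed) auto
    have "(g [^]\<^bsub>module_Aut R M\<^esub> Suc k) x = g ?y"
      using g x by (simp only: G.nat_pow_Suc2 module_Aut_mult_apply G.nat_pow_closed)
    then have "Q ((g [^]\<^bsub>module_Aut R M\<^esub> Suc k) x) = Q x \<oplus> l ?S \<oplus> l ?y"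
      using pow_closed by (simp only: Q_g Suc.IH)
    also have "\<dots> = Q x \<oplus> l (?y \<oplus>\<^bsub>M\<^esub> ?S)"
      using x S pow_closed by (simp add: l_add l_closed R.a_ac)
    also have "?y \<oplus>\<^bsub>M\<^esub> ?S = (\<Oplus>\<^bsub>M\<^esub>j\<in>{..<Suc k}. (g [^]\<^bsub>module_Aut R M\<^esub> j) x)"
      unfolding lessThan_Suc using pow_closed by (intro M.finsum_insert[symmetric]) auto
    finally show ?case .
  qed
qed

lemma Q_pow:
  assumes g: "g \<in> carrier (module_Aut R M)"
    and Q_g: "\<And>x. x \<in> carrier M \<Longrightarrow> Q (g x) = Q x"
    and x: "x \<in> carrier M"
  shows "Q ((g [^]\<^bsub>module_Aut R M\<^esub> (k :: nat)) x) = Q x"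
  using Q_pow_shift[of g "\<lambda>_. \<zero>" x k] assms by simp

end

section \<open>The data of the iterated matched product\<close>

lemma mult_H_add:
  "x \<otimes>\<^bsub>H_add p r n i\<^esub> y =
    (fst x \<oplus>\<^bsub>zmodule p r n i\<^esub> fst y, snd x \<oplus>\<^bsub>zring p r i\<^esub> snd y)"
  by (cases x; cases y) (simp add: H_add_def)

lemma carrier_H_add: "carrier (H_add p r n i) = carrier (zmodule p r n i) \<times> carrier (zring p r i)"
  by (simp add: H_add_def)

lemma carrier_zring: "carrier (zring p r i) = {0..int (p i ^ r i) - 1}"
  by (simp add: zring_def residue_ring_def)

lemma add_zring: "x \<oplus>\<^bsub>zring p r i\<^esub> y = (x + y) mod int (p i ^ r i)"
  by (simp add: zring_def residue_ring_def)

lemma zero_zring: "\<zero>\<^bsub>zring p r i\<^esub> = 0"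
  by (simp add: zring_def residue_ring_def)

text \<open>
  The conditions on the data in the form in which the proof uses them: orders enter only through
  powers equal to the identity, and membership in the orthogonal group is split into being an automorphism
  and preserving \<open>Q\<close>, since the two parts are available for different ranges of the index for \<open>c\<close>.
\<close>

locale matched_product_data =
  fixes s :: nat
    and p r n :: "nat \<Rightarrow> nat"
    and Q :: "nat \<Rightarrow> (nat \<Rightarrow> int) \<Rightarrow> int"
    and f c :: "nat \<Rightarrow> (nat \<Rightarrow> int) \<Rightarrow> nat \<Rightarrow> int"
    and v :: "nat \<Rightarrow> int"
  assumes s_pos: "1 \<le> s"
    and modulus: "i \<in> {1..s} \<Longrightarrow> 1 < p i ^ r i"
    and quadratic: "i \<in> {1..s} \<Longrightarrow> quadratic_form (zring p r i) (zmodule p r n i) (Q i)"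
    and f: "i \<in> {1..s} \<Longrightarrow> f i \<in> carrier (zAut p r n i)"
    and Q_f: "\<lbrakk>i \<in> {1..s}; x \<in> carrier (zmodule p r n i)\<rbrakk> \<Longrightarrow> Q i (f i x) = Q i x"
    and f_pow: "i \<in> {1..s} \<Longrightarrow> f i [^]\<^bsub>zAut p r n i\<^esub> (p i ^ r i) = \<one>\<^bsub>zAut p r n i\<^esub>"
    and c: "i \<in> {1..s} \<Longrightarrow> c i \<in> carrier (zAut p r n i)"
    and Q_c: "\<lbrakk>i \<in> {1..<s}; x \<in> carrier (zmodule p r n i)\<rbrakk> \<Longrightarrow> Q i (c i x) = Q i x"
    and c_pow: "i \<in> {1..s} \<Longrightarrow>
      c i [^]\<^bsub>zAut p r n i\<^esub> (p (cyc_next s i) ^ r (cyc_next s i)) = \<one>\<^bsub>zAut p r n i\<^esub>"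
    and v: "v \<in> carrier (zmodule p r n s)"
    and Q_c_last: "x \<in> carrier (zmodule p r n s) \<Longrightarrow>
      Q s (c s x) = Q s x \<oplus>\<^bsub>zring p r s\<^esub> dot (zring p r s) (n s) v x"
    and f_c: "i \<in> {1..s} \<Longrightarrow> f i \<otimes>\<^bsub>zAut p r n i\<^esub> c i = c i \<otimes>\<^bsub>zAut p r n i\<^esub> f i"
begin

abbreviation R where "R \<equiv> zring p r"
abbreviation M where "M \<equiv> zmodule p r n"
abbreviation \<beta> where "\<beta> i \<equiv> polar (R i) (M i) (Q i)"

lemma cring_R: "i \<in> {1..s} \<Longrightarrow> cring (R i)"
  unfolding zring_def using modulus[of i] of_nat_less_iff[of 1 "p i ^ r i", where 'a = int]
  by (intro residues.cring residues.intro) (simp only: of_nat_1)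

lemma quadratic_module_M:
  assumes "i \<in> {1..s}"
  shows "quadratic_module (R i) (M i) (Q i)"
  using cring.module_free_module[OF cring_R[OF assms], of "n i"] quadratic[OF assms]
  by (simp add: quadratic_module_def quadratic_module_axioms_def zmodule_def)

lemma group_Aut: "i \<in> {1..s} \<Longrightarrow> group (zAut p r n i)"
  using quadratic_module_M by (simp add: quadratic_module_def module.group_module_Aut)

lemma cyc_next_in: "i \<in> {1..s} \<Longrightarrow> cyc_next s i \<in> {1..s}"
  by (auto simp: cyc_next_def)

lemma R_nonneg: "\<lbrakk>a \<in> carrier (R i)\<rbrakk> \<Longrightarrow> 0 \<le> a"
  by (simp add: carrier_zring)

lemma dot_closed_M:
  "x \<in> carrier (M s) \<Longrightarrow> dot (R s) (n s) v x \<in> carrier (R s)"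
  using v s_pos by (simp add: zmodule_def cring.dot_closed cring_R del: free_module_simps)

lemma dot_add_M:
  "\<lbrakk>x \<in> carrier (M s); y \<in> carrier (M s)\<rbrakk> \<Longrightarrow>
    dot (R s) (n s) v (x \<oplus>\<^bsub>M s\<^esub> y) = dot (R s) (n s) v x \<oplus>\<^bsub>R s\<^esub> dot (R s) (n s) v y"
  using v s_pos by (simp add: zmodule_def cring.dot_add cring_R del: free_module_simps)

lemma polar_f:
  assumes i: "i \<in> {1..s}" and "x \<in> carrier (M i)" "y \<in> carrier (M i)"
  shows "\<beta> i (f i x) (f i y) = \<beta> i x y"
proof -
  interpret quadratic_module "R i" "M i" "Q i" by (rule quadratic_module_M[OF i])
  show ?thesis
    using assms f[OF i] by (intro polar_eq_if_Q_shift[where l = "\<lambda>_. \<zero>\<^bsub>R i\<^esub>"]) (simp_all add: Q_f)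
qed

lemma polar_c:
  assumes i: "i \<in> {1..s}" and x: "x \<in> carrier (M i)" and y: "y \<in> carrier (M i)"
  shows "\<beta> i (c i x) (c i y) = \<beta> i x y"
proof -
  interpret quadratic_module "R i" "M i" "Q i" by (rule quadratic_module_M[OF i])
  show ?thesis
  proof (cases "i = s")
    case True
    show ?thesis
      by (rule polar_eq_if_Q_shift[where l = "dot (R s) (n s) v", OF c[OF i] _ _ _ x y])
         (simp_all add: True dot_closed_M dot_add_M Q_c_last)
  next
    case False
    with i have "i \<in> {1..<s}" by auto
    then show ?thesis
      by (intro polar_eq_if_Q_shift[where l = "\<lambda>_. \<zero>\<^bsub>R i\<^esub>", OF c[OF i] _ _ _ x y])
         (simp_all add: Q_c)
  qed
qed

abbreviation tw where "tw \<equiv> twist s p r n f c"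

text \<open>
  The twist as an element of the automorphism group, so that its composition laws are those of the group.
\<close>

definition twist_Aut where
  "twist_Aut i \<mu> = f i [^]\<^bsub>zAut p r n i\<^esub> (\<mu> i :: int) \<otimes>\<^bsub>zAut p r n i\<^esub> c i [^]\<^bsub>zAut p r n i\<^esub> (\<mu> (cyc_next s i) :: int)"

lemma twist_Aut_closed: "i \<in> {1..s} \<Longrightarrow> twist_Aut i \<mu> \<in> carrier (zAut p r n i)"
  by (simp add: twist_Aut_def group_Aut f c group.is_monoid monoid.m_closed group.int_pow_closed)

lemma twist_eq:
  assumes "i \<in> {1..s}" "y \<in> carrier (M i)"
  shows "tw i \<mu> y = twist_Aut i \<mu> y"
  using assms
  by (simp add: twist_def twist_Aut_def module_Aut_mult_apply group_Aut f c group.int_pow_closed)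

lemma twist_closed: "\<lbrakk>i \<in> {1..s}; y \<in> carrier (M i)\<rbrakk> \<Longrightarrow> tw i \<mu> y \<in> carrier (M i)"
  using twist_Aut_closed[of i \<mu>] by (simp add: twist_eq module_Aut_closed)

lemma twist_add_right:
  assumes "i \<in> {1..s}" "x \<in> carrier (M i)" "y \<in> carrier (M i)"
  shows "tw i \<mu> (x \<oplus>\<^bsub>M i\<^esub> y) = tw i \<mu> x \<oplus>\<^bsub>M i\<^esub> tw i \<mu> y"
proof -
  interpret quadratic_module "R i" "M i" "Q i" by (rule quadratic_module_M[OF assms(1)])
  show ?thesis
    using twist_Aut_closed[of i \<mu>] assms by (simp add: twist_eq module_Aut_iff)
qed

lemma twist_cong:
  "\<lbrakk>i \<in> {1..s}; \<And>j. j \<in> {1..s} \<Longrightarrow> \<mu> j = \<nu> j\<rbrakk> \<Longrightarrow> tw i \<mu> = tw i \<nu>"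
  using cyc_next_in[of i] by (simp add: twist_def fun_eq_iff del: atLeastAtMost_iff)

lemma twist_zero:
  assumes i: "i \<in> {1..s}" and y: "y \<in> carrier (M i)" and \<mu>: "\<And>j. j \<in> {1..s} \<Longrightarrow> \<mu> j = 0"
  shows "tw i \<mu> y = y"
proof -
  interpret G: group "zAut p r n i" by (rule group_Aut[OF i])
  show ?thesis
    using i y \<mu>[OF i] \<mu>[OF cyc_next_in[OF i]]
    by (simp add: twist_def one_module_Aut)
qed

text \<open>
  This makes \<open>\<mu> \<mapsto> f\<^sub>i\<^bsup>\<mu>\<^sub>i\<^esup> c\<^sub>i\<^bsup>\<mu>\<^sub>i\<^sub>+\<^sub>1\<^esup>\<close> an action of \<open>S'\<close>: the two families of powers
  commute, and reducing exponents is harmless because of the orders.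
  The assumption on \<open>\<pi>\<close> is pointwise on \<open>{1..s}\<close>, because the sum of \<open>S'\<close> is a restricted function.
\<close>

lemma twist_add_left:
  assumes i: "i \<in> {1..s}" and y: "y \<in> carrier (M i)"
    and \<mu>: "\<And>j. j \<in> {1..s} \<Longrightarrow> \<mu> j \<in> carrier (R j)"
    and \<nu>: "\<And>j. j \<in> {1..s} \<Longrightarrow> \<nu> j \<in> carrier (R j)"
    and \<pi>: "\<And>j. j \<in> {1..s} \<Longrightarrow> \<pi> j = \<mu> j \<oplus>\<^bsub>R j\<^esub> \<nu> j"
  shows "tw i \<pi> y = tw i \<mu> (tw i \<nu> y)"
proof -
  interpret G: group "zAut p r n i" by (rule group_Aut[OF i])
  let ?j = "cyc_next s i"
  have j: "?j \<in> {1..s}" by (rule cyc_next_in[OF i])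
  let ?f = "\<lambda>k. f i [^]\<^bsub>zAut p r n i\<^esub> (k :: int)" and ?c = "\<lambda>k. c i [^]\<^bsub>zAut p r n i\<^esub> (k :: int)"
  have closed: "?f k \<in> carrier (zAut p r n i)" "?c k \<in> carrier (zAut p r n i)" for k
    using f[OF i] c[OF i] by simp_all
  have comm: "?f (\<nu> i) \<otimes>\<^bsub>zAut p r n i\<^esub> ?c (\<mu> ?j) = ?c (\<mu> ?j) \<otimes>\<^bsub>zAut p r n i\<^esub> ?f (\<nu> i)"
    by (rule G.int_pow_commute[OF f_c[OF i] f[OF i] c[OF i] R_nonneg[OF \<nu>[OF i]] R_nonneg[OF \<mu>[OF j]]])
  have "twist_Aut i \<pi> = (?f (\<mu> i) \<otimes>\<^bsub>zAut p r n i\<^esub> ?f (\<nu> i)) \<otimes>\<^bsub>zAut p r n i\<^esub>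
      (?c (\<mu> ?j) \<otimes>\<^bsub>zAut p r n i\<^esub> ?c (\<nu> ?j))"
    unfolding twist_Aut_def \<pi>[OF i] \<pi>[OF j] add_zring
    by (simp only: G.int_pow_add_mod[OF f[OF i] f_pow[OF i]] G.int_pow_add_mod[OF c[OF i] c_pow[OF i]])
  also have "\<dots> = ?f (\<mu> i) \<otimes>\<^bsub>zAut p r n i\<^esub>
      ((?f (\<nu> i) \<otimes>\<^bsub>zAut p r n i\<^esub> ?c (\<mu> ?j)) \<otimes>\<^bsub>zAut p r n i\<^esub> ?c (\<nu> ?j))"
    by (simp only: G.m_assoc closed G.m_closed)
  also have "\<dots> = twist_Aut i \<mu> \<otimes>\<^bsub>zAut p r n i\<^esub> twist_Aut i \<nu>"
    unfolding comm twist_Aut_def by (simp only: G.m_assoc closed G.m_closed)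
  finally show ?thesis
    using i y module_Aut_closed[OF twist_Aut_closed[OF i] y]
    by (simp add: twist_eq module_Aut_mult_apply twist_Aut_closed)
qed

text \<open>
  Exponents are canonical representatives, hence non-negative, so that induction over natural powers applies.
\<close>

lemma twist_nat:
  assumes "i \<in> {1..s}" "\<And>j. j \<in> {1..s} \<Longrightarrow> \<mu> j \<in> carrier (R j)"
  shows "tw i \<mu> y = (f i [^]\<^bsub>zAut p r n i\<^esub> nat (\<mu> i))
    ((c i [^]\<^bsub>zAut p r n i\<^esub> nat (\<mu> (cyc_next s i))) y)"
  using R_nonneg[OF assms(2)[OF assms(1)]] R_nonneg[OF assms(2)[OF cyc_next_in[OF assms(1)]]]
  by (simp add: twist_def)

lemma c_pow_closed:
  assumes i: "i \<in> {1..s}" and "y \<in> carrier (M i)"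
  shows "(c i [^]\<^bsub>zAut p r n i\<^esub> (k :: nat)) y \<in> carrier (M i)"
proof -
  interpret G: group "zAut p r n i" by (rule group_Aut[OF i])
  show ?thesis
    by (rule module_Aut_closed[OF G.nat_pow_closed[OF c[OF i]] assms(2)])
qed

lemma twist_polar:
  assumes i: "i \<in> {1..s}" and \<mu>: "\<And>j. j \<in> {1..s} \<Longrightarrow> \<mu> j \<in> carrier (R j)"
    and x: "x \<in> carrier (M i)" and y: "y \<in> carrier (M i)"
  shows "\<beta> i (tw i \<mu> x) (tw i \<mu> y) = \<beta> i x y"
proof -
  interpret quadratic_module "R i" "M i" "Q i" by (rule quadratic_module_M[OF i])
  have tw: "tw i \<mu> z = (f i [^]\<^bsub>zAut p r n i\<^esub> nat (\<mu> i))
      ((c i [^]\<^bsub>zAut p r n i\<^esub> nat (\<mu> (cyc_next s i))) z)" for z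
    using i \<mu> by (rule twist_nat)
  show ?thesis
    unfolding tw
    by (simp only: polar_pow[OF f[OF i] polar_f[OF i]] polar_pow[OF c[OF i] polar_c[OF i]]
        c_pow_closed[OF i] x y)
qed

text \<open>
  The additional term by which the twist changes \<open>Q\<^sub>i\<close>; it vanishes for \<open>i < s\<close>.
\<close>

definition shift where
  "shift i k y = (if i < s then \<zero>\<^bsub>R i\<^esub>
    else dot (R i) (n i) v (\<Oplus>\<^bsub>M i\<^esub>j\<in>{..<k}. (c i [^]\<^bsub>zAut p r n i\<^esub> (j :: nat)) y))"

lemma shift_closed:
  assumes i: "i \<in> {1..s}" and y: "y \<in> carrier (M i)"
  shows "shift i k y \<in> carrier (R i)"
proof -
  interpret quadratic_module "R i" "M i" "Q i" by (rule quadratic_module_M[OF i])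
  have "(\<Oplus>\<^bsub>M i\<^esub>j\<in>{..<k}. (c i [^]\<^bsub>zAut p r n i\<^esub> (j :: nat)) y) \<in> carrier (M i)"
    using c_pow_closed[OF i y] by (intro M.finsum_closed) simp
  moreover have "i = s" if "\<not> i < s"
    using that i by simp
  ultimately show ?thesis
    by (auto simp: shift_def dot_closed_M)
qed

text \<open>
  For \<open>i < s\<close> both factors of the twist are isometries. For \<open>i = s\<close> only \<open>f\<^sub>s\<close> need be one, and the power of \<open>c\<^sub>s\<close>
  contributes the orbit sum.
\<close>

lemma Q_twist:
  assumes i: "i \<in> {1..s}" and y: "y \<in> carrier (M i)"
    and \<mu>: "\<And>j. j \<in> {1..s} \<Longrightarrow> \<mu> j \<in> carrier (R j)"
  shows "Q i (tw i \<mu> y) = Q i y \<oplus>\<^bsub>R i\<^esub> shift i (nat (\<mu> (cyc_next s i))) y"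
proof -
  interpret quadratic_module "R i" "M i" "Q i" by (rule quadratic_module_M[OF i])
  let ?k = "nat (\<mu> (cyc_next s i))"
  have "Q i (tw i \<mu> y) = Q i ((c i [^]\<^bsub>zAut p r n i\<^esub> ?k) y)"
    using Q_pow[OF f[OF i] Q_f[OF i] c_pow_closed[OF i y]] twist_nat[OF i \<mu>] by simp
  also have "\<dots> = Q i y \<oplus>\<^bsub>R i\<^esub> shift i ?k y"
  proof (cases "i < s")
    case True
    with i have "i \<in> {1..<s}" by simp
    with True show ?thesis
      using Q_pow[OF c[OF i] Q_c y] y by (simp add: shift_def)
  next
    case False
    with i have "i = s" by simp
    then show ?thesis
      using Q_pow_shift[where l = "dot (R s) (n s) v", OF c[OF i] _ _ _ y]
      by (simp add: shift_def dot_closed_M dot_add_M Q_c_last)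
  qed
  finally show ?thesis .
qed

section \<open>The asymmetric product is a left brace\<close>

lemma minus_polar:
  assumes i: "i \<in> {1..s}" and x: "x \<in> carrier (M i)" and y: "y \<in> carrier (M i)"
  shows minus_polar_closed: "\<ominus>\<^bsub>R i\<^esub> \<beta> i x y \<in> carrier (R i)"
    and minus_polar_sym: "\<ominus>\<^bsub>R i\<^esub> \<beta> i x y = \<ominus>\<^bsub>R i\<^esub> \<beta> i y x"
    and minus_polar_add: "z \<in> carrier (M i) \<Longrightarrow>
      \<ominus>\<^bsub>R i\<^esub> \<beta> i (x \<oplus>\<^bsub>M i\<^esub> y) z = \<ominus>\<^bsub>R i\<^esub> \<beta> i x z \<oplus>\<^bsub>R i\<^esub> \<ominus>\<^bsub>R i\<^esub> \<beta> i y z"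
proof -
  interpret quadratic_module "R i" "M i" "Q i" by (rule quadratic_module_M[OF i])
  show "\<ominus>\<^bsub>R i\<^esub> \<beta> i x y \<in> carrier (R i)" "\<ominus>\<^bsub>R i\<^esub> \<beta> i x y = \<ominus>\<^bsub>R i\<^esub> \<beta> i y x"
    using x y by (simp_all add: polar_sym)
  show "\<ominus>\<^bsub>R i\<^esub> \<beta> i (x \<oplus>\<^bsub>M i\<^esub> y) z = \<ominus>\<^bsub>R i\<^esub> \<beta> i x z \<oplus>\<^bsub>R i\<^esub> \<ominus>\<^bsub>R i\<^esub> \<beta> i y z"
    if "z \<in> carrier (M i)"
    using x y that by (simp add: polar_add R.minus_add)
qed

lemma left_brace_asym_brace: "left_brace (asym_brace s p r n Q f c)"
  unfolding asym_brace_def T_brace_def S_brace_def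
proof (rule left_brace_asym_product_trivial, goal_cases)
  case 1
  show ?case
    using quadratic_module_M
    by (intro comm_group_product_group)
       (simp add: quadratic_module_def module_def abelian_group.a_comm_group)
next
  case 2
  show ?case
    by (intro comm_group_product_group abelian_group.a_comm_group)
       (simp add: cring_R cring.axioms ring.is_abelian_group cring.is_cring)
next
  case (3 t u)
  then show ?case
    by (auto simp: b'_def PiE_iff minus_polar_closed)
next
  case (4 t u)
  then show ?case
    by (auto simp: b'_def PiE_iff intro!: restrict_ext minus_polar_sym)
next
  case (5 t u w)
  then show ?case
    by (auto simp: b'_def PiE_iff minus_polar_add intro!: restrict_ext)
next
  case (6 x)
  then show ?case
    by (auto simp: hom_def alpha'_def PiE_iff twist_closed twist_add_right intro!: restrict_ext)
next
  case (7 t)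
  then show ?case
    by (intro extensionalityI[where A = "{1..s}" and g = t])
       (auto simp: alpha'_def PiE_iff zero_zring intro!: twist_zero)
next
  case (8 x y t)
  then show ?case
    by (auto simp: alpha'_def PiE_iff intro!: restrict_ext twist_add_left)
next
  case (9 x t u)
  then show ?case
    by (auto simp: alpha'_def b'_def PiE_iff intro!: restrict_ext arg_cong[where f = "a_inv _"] twist_polar)
qed

section \<open>The matched product is isomorphic to the asymmetric product\<close>

abbreviation H where "H \<equiv> product_group {1..s} (H_add p r n)"
abbreviation L where "L \<equiv> matched_lambda s p r n Q f c v"

lemma carrier_H_apply:
  assumes "a \<in> carrier H" "i \<in> {1..s}"
  shows "fst (a i) \<in> carrier (M i)" "snd (a i) \<in> carrier (R i)"
  using assms by (auto simp: PiE_iff carrier_H_add mem_Times_iff)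

lemma Q_closed_M: "\<lbrakk>i \<in> {1..s}; x \<in> carrier (M i)\<rbrakk> \<Longrightarrow> Q i x \<in> carrier (R i)"
  by (rule quadratic_module.Q_closed[OF quadratic_module_M])

lemma qval_closed: "\<lbrakk>a \<in> carrier H; i \<in> {1..s}\<rbrakk> \<Longrightarrow> qval p r Q a i \<in> carrier (R i)"
  using cring_R[of i] carrier_H_apply[of a i] Q_closed_M[of i "fst (a i)"]
  by (simp add: qval_def cring_def ring_def abelian_group.minus_closed)

text \<open>
  With the term \<open>shift\<close> the components \<open>i < s\<close> and \<open>i = s\<close> of the lambda map take the same form.
\<close>

lemma matched_lambda_apply:
  assumes i: "i \<in> {1..s}" and a: "a \<in> carrier H" and a': "a' \<in> carrier H"
  defines "q \<equiv> qval p r Q a"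
  defines "z \<equiv> tw i q (fst (a' i))"
  shows "fst (L a a' i) = z"
    and "snd (L a a' i) = snd (a' i) \<oplus>\<^bsub>R i\<^esub> shift i (nat (q (cyc_next s i))) (fst (a' i))
      \<oplus>\<^bsub>R i\<^esub> \<beta> i (fst (a i)) z"
proof -
  interpret quadratic_module "R i" "M i" "Q i" by (rule quadratic_module_M[OF i])
  show "fst (L a a' i) = z"
    using i by (simp add: matched_lambda_def Let_def z_def q_def)
  show "snd (L a a' i) = snd (a' i) \<oplus>\<^bsub>R i\<^esub> shift i (nat (q (cyc_next s i))) (fst (a' i))
      \<oplus>\<^bsub>R i\<^esub> \<beta> i (fst (a i)) z"
  proof (cases "i < s")
    case True
    then show ?thesis
      using i carrier_H_apply[OF a' i]
      by (simp add: matched_lambda_def Let_def z_def q_def shift_def)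
  next
    case False
    with i have "i = s" by simp
    then show ?thesis
      using i by (simp add: matched_lambda_def Let_def z_def q_def shift_def cyc_next_def)
  qed
qed

lemma matched_lambda_closed:
  assumes a: "a \<in> carrier H" and a': "a' \<in> carrier H"
  shows "L a a' \<in> carrier H"
proof -
  have "L a a' i \<in> carrier (M i) \<times> carrier (R i)" if i: "i \<in> {1..s}" for i
  proof -
    interpret quadratic_module "R i" "M i" "Q i" by (rule quadratic_module_M[OF i])
    show ?thesis
      using carrier_H_apply[OF a i] carrier_H_apply[OF a' i] i
      by (simp add: mem_Times_iff matched_lambda_apply[OF i a a'] twist_closed shift_closed
          del: atLeastAtMost_iff)
  qed
  moreover have "L a a' \<in> extensional {1..s}"
    by (simp add: matched_lambda_def)
  ultimately show ?thesis
    by (simp add: PiE_iff carrier_H_add del: atLeastAtMost_iff)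
qed

lemma group_H: "group H"
proof (rule product_group)
  fix i assume i: "i \<in> {1..s}"
  interpret quadratic_module "R i" "M i" "Q i" by (rule quadratic_module_M[OF i])
  show "group (H_add p r n i)"
    unfolding H_add_def by (intro DirProd_group M.a_group R.a_group)
qed

lemma carrier_asym_brace:
  "carrier (asym_brace s p r n Q f c) = (\<Pi>\<^sub>E i\<in>{1..s}. carrier (M i)) \<times> (\<Pi>\<^sub>E i\<in>{1..s}. carrier (R i))"
  by (simp add: asym_brace_def T_brace_def S_brace_def)

lemma phi'_closed:
  assumes a: "a \<in> carrier H"
  shows "phi' s p r Q a \<in> carrier (asym_brace s p r n Q f c)"
proof -
  have "phi' s p r Q a = (\<lambda>i\<in>{1..s}. fst (a i), \<lambda>i\<in>{1..s}. qval p r Q a i)"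
    by (simp add: phi'_def qval_def)
  then show ?thesis
    by (simp add: carrier_asym_brace PiE_iff carrier_H_apply[OF a] qval_closed[OF a]
        del: atLeastAtMost_iff)
qed

lemma phi'_bij: "bij_betw (phi' s p r Q) (carrier H) (carrier (asym_brace s p r n Q f c))"
proof (rule bij_betw_byWitness
    [where f' = "\<lambda>(t, q). \<lambda>i\<in>{1..s}. (t i, q i \<oplus>\<^bsub>R i\<^esub> Q i (t i))"])
  let ?g = "\<lambda>(t, q). \<lambda>i\<in>{1..s}. (t i, q i \<oplus>\<^bsub>R i\<^esub> Q i (t i))"
  show "\<forall>a\<in>carrier H. ?g (phi' s p r Q a) = a"
  proof
    fix a assume a: "a \<in> carrier H"
    show "?g (phi' s p r Q a) = a"
    proof (rule extensionalityI[of _ "{1..s}"])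
      fix i assume i: "i \<in> {1..s}"
      interpret quadratic_module "R i" "M i" "Q i" by (rule quadratic_module_M[OF i])
      show "?g (phi' s p r Q a) i = a i"
        using i carrier_H_apply[OF a i]
        by (simp add: phi'_def R.minus_add_cancel)
    qed (use a in \<open>simp_all add: phi'_def PiE_iff\<close>)
  qed
  show "\<forall>b\<in>carrier (asym_brace s p r n Q f c). phi' s p r Q (?g b) = b"
  proof
    fix b assume "b \<in> carrier (asym_brace s p r n Q f c)"
    then obtain t q where b: "b = (t, q)" and t: "t \<in> (\<Pi>\<^sub>E i\<in>{1..s}. carrier (M i))"
      and q: "q \<in> (\<Pi>\<^sub>E i\<in>{1..s}. carrier (R i))"
      by (auto simp: carrier_asym_brace)
    have "q i \<oplus>\<^bsub>R i\<^esub> Q i (t i) \<ominus>\<^bsub>R i\<^esub> Q i (t i) = q i" if i: "i \<in> {1..s}" for i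
    proof -
      interpret quadratic_module "R i" "M i" "Q i" by (rule quadratic_module_M[OF i])
      show ?thesis
        using PiE_mem[OF t i] PiE_mem[OF q i] by (simp add: R.minus_eqI)
    qed
    then have "phi' s p r Q (?g b) = (restrict t {1..s}, restrict q {1..s})"
      by (simp add: b phi'_def cong: restrict_cong del: atLeastAtMost_iff)
    then show "phi' s p r Q (?g b) = b"
      using t q by (simp add: b PiE_restrict)
  qed
  show "phi' s p r Q ` carrier H \<subseteq> carrier (asym_brace s p r n Q f c)"
    using phi'_closed by blast
  have "q i \<oplus>\<^bsub>R i\<^esub> Q i (t i) \<in> carrier (R i)"
    if i: "i \<in> {1..s}" and "t i \<in> carrier (M i)" "q i \<in> carrier (R i)" for i t q
    using that cring_R[OF i] Q_closed_M[of i "t i"]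
    by (simp add: cring_def ring_def abelian_group.axioms abelian_monoid.a_closed)
  then show "?g ` carrier (asym_brace s p r n Q f c) \<subseteq> carrier H"
    by (auto simp: carrier_asym_brace PiE_iff carrier_H_add)
qed

text \<open>
  The twisting term \<open>-b\<^sub>i\<close> in the sum of \<open>B\<close> is precisely the defect of additivity of \<open>-Q\<^sub>i\<close>.
\<close>

lemma phi'_add:
  assumes a: "a \<in> carrier H" and a': "a' \<in> carrier H"
  shows "phi' s p r Q (a \<otimes>\<^bsub>H\<^esub> a') = phi' s p r Q a \<oplus>\<^bsub>asym_brace s p r n Q f c\<^esub> phi' s p r Q a'"
proof -
  have "snd (a i) \<oplus>\<^bsub>R i\<^esub> snd (a' i) \<ominus>\<^bsub>R i\<^esub> Q i (fst (a i) \<oplus>\<^bsub>M i\<^esub> fst (a' i))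
      = snd (a i) \<ominus>\<^bsub>R i\<^esub> Q i (fst (a i)) \<oplus>\<^bsub>R i\<^esub> (snd (a' i) \<ominus>\<^bsub>R i\<^esub> Q i (fst (a' i)))
        \<oplus>\<^bsub>R i\<^esub> \<ominus>\<^bsub>R i\<^esub> \<beta> i (fst (a i)) (fst (a' i))"
    if i: "i \<in> {1..s}" for i
  proof -
    interpret quadratic_module "R i" "M i" "Q i" by (rule quadratic_module_M[OF i])
    show ?thesis
      using carrier_H_apply[OF a i] carrier_H_apply[OF a' i]
      by (simp add: Q_add R.minus_minus_cong)
  qed
  then show ?thesis
    by (simp add: phi'_def asym_brace_def T_brace_def S_brace_def b'_def mult_H_add
        cong: restrict_cong del: atLeastAtMost_iff)
qed

text \<open>
  The second component of the product in \<open>B\<close> is a plain sum, so \<open>\<mu>\<^sub>i - Q\<^sub>i(x\<^sub>i)\<close> must be additive along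
  products. Put \<open>z = twist y\<close>. Then \<open>Q\<^sub>i(x + z) = Q\<^sub>i(x) + Q\<^sub>i(y) + shift + b\<^sub>i(x, z)\<close>, and the lambda map adds
  exactly \<open>shift + b\<^sub>i(x, z)\<close> to \<open>\<mu>'\<close>, so that these terms cancel.
\<close>

lemma phi'_mult:
  assumes a: "a \<in> carrier H" and a': "a' \<in> carrier H"
  shows "phi' s p r Q (a \<otimes>\<^bsub>H\<^esub> L a a')
    = phi' s p r Q a \<otimes>\<^bsub>asym_brace s p r n Q f c\<^esub> phi' s p r Q a'"
proof -
  let ?q = "qval p r Q a"
  have fst: "fst (L a a' i) = tw i (\<lambda>i\<in>{1..s}. ?q i) (fst (a' i))" if i: "i \<in> {1..s}" for i
    using matched_lambda_apply(1)[OF i a a'] twist_cong[OF i, of ?q "\<lambda>i\<in>{1..s}. ?q i"] by simp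
  have snd: "snd (a i) \<oplus>\<^bsub>R i\<^esub> snd (L a a' i) \<ominus>\<^bsub>R i\<^esub> Q i (fst (a i) \<oplus>\<^bsub>M i\<^esub> fst (L a a' i))
      = ?q i \<oplus>\<^bsub>R i\<^esub> qval p r Q a' i"
    if i: "i \<in> {1..s}" for i
  proof -
    interpret quadratic_module "R i" "M i" "Q i" by (rule quadratic_module_M[OF i])
    define w where "w = shift i (nat (?q (cyc_next s i))) (fst (a' i))"
    define z where "z = tw i ?q (fst (a' i))"
    define \<gamma> where "\<gamma> = \<beta> i (fst (a i)) z"
    have z: "z \<in> carrier (M i)" and w: "w \<in> carrier (R i)"
      unfolding z_def w_def using carrier_H_apply[OF a' i] i
      by (simp_all add: twist_closed shift_closed del: atLeastAtMost_iff)
    have Qz: "Q i z = Q i (fst (a' i)) \<oplus>\<^bsub>R i\<^esub> w"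
      unfolding z_def w_def using carrier_H_apply[OF a' i] by (intro Q_twist i qval_closed[OF a])
    note closed = carrier_H_apply[OF a i] carrier_H_apply[OF a' i] z w
    have \<gamma>: "\<gamma> \<in> carrier (R i)"
      using closed by (simp add: \<gamma>_def)
    have "?q i \<oplus>\<^bsub>R i\<^esub> qval p r Q a' i \<oplus>\<^bsub>R i\<^esub> (Q i (fst (a i)) \<oplus>\<^bsub>R i\<^esub> (Q i (fst (a' i)) \<oplus>\<^bsub>R i\<^esub> w) \<oplus>\<^bsub>R i\<^esub> \<gamma>)
        = (?q i \<oplus>\<^bsub>R i\<^esub> Q i (fst (a i))) \<oplus>\<^bsub>R i\<^esub> ((qval p r Q a' i \<oplus>\<^bsub>R i\<^esub> Q i (fst (a' i))) \<oplus>\<^bsub>R i\<^esub> w \<oplus>\<^bsub>R i\<^esub> \<gamma>)"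
      by (simp only: R.a_ac R.a_closed Q_closed closed \<gamma> qval_closed[OF a i] qval_closed[OF a' i])
    also have "\<dots> = snd (a i) \<oplus>\<^bsub>R i\<^esub> (snd (a' i) \<oplus>\<^bsub>R i\<^esub> w \<oplus>\<^bsub>R i\<^esub> \<gamma>)"
      using closed by (simp add: qval_def R.minus_add_cancel)
    finally show ?thesis
      unfolding matched_lambda_apply[OF i a a'] z_def[symmetric] w_def[symmetric]
      using closed \<gamma> qval_closed[OF a i] qval_closed[OF a' i]
      by (intro R.minus_eqI) (simp_all add: Q_add Qz \<gamma>_def)
  qed
  have "phi' s p r Q (a \<otimes>\<^bsub>H\<^esub> L a a')
      = (\<lambda>i\<in>{1..s}. fst (a i) \<oplus>\<^bsub>M i\<^esub> fst (L a a' i), \<lambda>i\<in>{1..s}. ?q i \<oplus>\<^bsub>R i\<^esub> qval p r Q a' i)"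
    by (simp add: phi'_def mult_H_add snd cong: restrict_cong del: atLeastAtMost_iff)
  moreover have "phi' s p r Q a \<otimes>\<^bsub>asym_brace s p r n Q f c\<^esub> phi' s p r Q a'
      = (\<lambda>i\<in>{1..s}. fst (a i) \<oplus>\<^bsub>M i\<^esub> tw i (\<lambda>i\<in>{1..s}. ?q i) (fst (a' i)),
         \<lambda>i\<in>{1..s}. ?q i \<oplus>\<^bsub>R i\<^esub> qval p r Q a' i)"
    by (simp add: phi'_def qval_def asym_brace_def T_brace_def S_brace_def alpha'_def
        cong: restrict_cong del: atLeastAtMost_iff)
  ultimately show ?thesis
    by (simp add: fst cong: restrict_cong del: atLeastAtMost_iff)
qed

lemma phi'_brace_iso:
  "phi' s p r Q \<in> brace_iso (matched_product s p r n Q f c v) (asym_brace s p r n Q f c)"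
  using phi'_bij phi'_add phi'_mult by (simp add: brace_iso_def matched_product_def)

lemma left_brace_matched_product: "left_brace (matched_product s p r n Q f c v)"
  using group_H matched_lambda_closed left_brace_asym_brace phi'_brace_iso
  unfolding matched_product_def by (rule left_brace_transport)

end

section \<open>The isomorphism theorem\<close>

theorem theorem6p2:
  fixes s :: nat
    and p r r' n :: "nat \<Rightarrow> nat"
    and Q :: "nat \<Rightarrow> (nat \<Rightarrow> int) \<Rightarrow> int"
    and f c :: "nat \<Rightarrow> (nat \<Rightarrow> int) \<Rightarrow> nat \<Rightarrow> int"
    and v :: "nat \<Rightarrow> int"
  assumes "s > 1"
    and "\<forall>i\<in>{1..s}. prime (p i)"
    and "inj_on p {1..s}"
    and "\<forall>i\<in>{1..<s}. odd (p i)"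
    and "\<forall>i\<in>{1..s}. r i > 0"
    and "\<forall>i\<in>{1..s}. n i > 0"
    and "\<forall>i\<in>{1..s}. quadratic_form (zring p r i) (zmodule p r n i) (Q i)"
    and "\<forall>i\<in>{1..s}. nondegenerate (zring p r i) (zmodule p r n i) (Q i)"
    and "\<forall>i\<in>{1..s}. r' i \<le> r i"
    and "\<forall>i\<in>{1..s}. f i \<in> carrier (orthogonal_group (zring p r i) (zmodule p r n i) (Q i))"
    and "\<forall>i\<in>{1..s}.
          group.ord (orthogonal_group (zring p r i) (zmodule p r n i) (Q i)) (f i) = p i ^ r' i"
    and "\<forall>i\<in>{1..<s}. c i \<in> carrier (orthogonal_group (zring p r i) (zmodule p r n i) (Q i))"
    and "\<forall>i\<in>{1..<s}.
          group.ord (orthogonal_group (zring p r i) (zmodule p r n i) (Q i)) (c i)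
            = p (i + 1) ^ r (i + 1)"
    and "c s \<in> carrier (zAut p r n s)"
    and "group.ord (zAut p r n s) (c s) = p 1 ^ r 1"
    and "v \<in> carrier (zmodule p r n s)"
    and "\<forall>x\<in>carrier (zmodule p r n s).
          Q s (c s x) = Q s x \<oplus>\<^bsub>zring p r s\<^esub> dot (zring p r s) (n s) v x"
    and "\<forall>i\<in>{1..s}. f i \<otimes>\<^bsub>zAut p r n i\<^esub> c i = c i \<otimes>\<^bsub>zAut p r n i\<^esub> f i"
  shows "left_brace (matched_product s p r n Q f c v) \<and>
         left_brace (asym_brace s p r n Q f c) \<and>
         phi' s p r Q \<in> brace_iso (matched_product s p r n Q f c v) (asym_brace s p r n Q f c)"
proof -
  let ?R = "zring p r" and ?M = "zmodule p r n"
  have modulus: "1 < p i ^ r i" if "i \<in> {1..s}" for i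
    using assms(2,5) that by (intro one_less_power) (auto simp: prime_gt_Suc_0_nat)
  have module: "module (?R i) (?M i)" if "i \<in> {1..s}" for i
  proof -
    have "residues (int (p i ^ r i))"
      using modulus[OF that] of_nat_less_iff[of 1 "p i ^ r i", where 'a = int]
      by (intro residues.intro) (simp only: of_nat_1)
    then show ?thesis
      unfolding zmodule_def zring_def by (intro cring.module_free_module residues.cring)
  qed
  have pow_ord: "g [^]\<^bsub>zAut p r n i\<^esub> k = \<one>\<^bsub>zAut p r n i\<^esub>"
    if "i \<in> {1..s}" "g \<in> carrier (orthogonal_group (?R i) (?M i) (Q i))"
      "group.ord (orthogonal_group (?R i) (?M i) (Q i)) g dvd k" for i g and k :: nat
  proof -
    have "g [^]\<^bsub>orthogonal_group (?R i) (?M i) (Q i)\<^esub> k = \<one>\<^bsub>orthogonal_group (?R i) (?M i) (Q i)\<^esub>"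
      using that group.pow_eq_id[OF module.group_orthogonal_group[OF module[OF that(1)]] that(2)]
      by simp
    then show ?thesis
      by (simp add: nat_pow_orthogonal_group) (simp add: orthogonal_group_def)
  qed
  interpret matched_product_data s p r n Q f c v
  proof
    fix i assume i: "i \<in> {1..s}"
    show "f i [^]\<^bsub>zAut p r n i\<^esub> (p i ^ r i) = \<one>\<^bsub>zAut p r n i\<^esub>"
      using assms(9,10,11) i by (intro pow_ord) (auto simp: le_imp_power_dvd)
    show "c i [^]\<^bsub>zAut p r n i\<^esub> (p (cyc_next s i) ^ r (cyc_next s i)) = \<one>\<^bsub>zAut p r n i\<^esub>"
    proof (cases "i = s")
      case True
      then show ?thesis
        using group.pow_ord_eq_1[OF module.group_module_Aut[OF module[OF i]], of "c s"] assms(14,15)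
        by (simp add: cyc_next_def)
    next
      case False
      then show ?thesis
        using assms(12,13) i by (intro pow_ord) (auto simp: cyc_next_def)
    qed
    show "c i \<in> carrier (zAut p r n i)"
      using assms(12,14) i by (cases "i = s") (auto simp: orthogonal_group_def)
  qed (use assms modulus in \<open>auto simp: orthogonal_group_def\<close>)
  show ?thesis
    using left_brace_matched_product left_brace_asym_brace phi'_brace_iso by blast
qed

end
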